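(* Let $U^\star$ be a critical point of $f_{\mathrm{LR}}$ satisfying $U^\star{U^\star}^\top=X^\star$, and suppose conditions (I) and (N) of the context hold. Suppose there exist two distinct vertices $\nu_1,\nu_2$ of $\Lambda_C$, a linear subspace $\mathcal W\subseteq\ker\mathcal J_C$, and two nonempty relatively open cones $\mathcal C_1,\mathcal C_2\subseteq\mathcal W$ such that $$P_{\mathcal N_C}\mathcal Q_C(V)\in\operatorname{relint}N^{\mathcal N_C}_{\Lambda_C}(\nu_j)\qquad\text{for all }V\in\mathcal C_j,\ j=1,2.$$ Then $f_{\mathrm{LR}}$ admits no $C^2$ identifiable manifold at $U^\star$ for $0\in\partial f_{\mathrm{LR}}(U^\star)$; that is, $U^\star$ is inactive.
   Context: Robust low-rank recovery. $\mathbb S^n$ is the space of symmetric $n\times n$ matrices with the Frobenius inner product. Given $A_1,\dots,A_m\in\mathbb S^n$, let $\mathcal A:\mathbb S^n\to\mathbb R^m$, $[\mathcal A(Z)]_i=\langle A_i,Z\rangle$; let $\mathcal L:\mathbb S^n\to\mathbb S^n$ be linear, $X^\star\succeq0$ of rank $r\le k$, $\varepsilon\in\mathbb R^m$, $y=\mathcal A(\mathcal L(X^\star))+\varepsilon$, and $f_{\mathrm{LR}}(U)=\|\mathcal A(\mathcal L(UU^\top))-y\|_1$ for $U\in\mathbb R^{n\times k}$. Let $\Omega_C=\{i:\varepsilon_i=0\}$, $\Omega_N=\{i:\varepsilon_i\ne0\}$, $m_C=|\Omega_C|$, $m_N=|\Omega_N|$; subscripts $C$, $N$ on $\mathcal A$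 and $\varepsilon$ denote restriction to these coordinates. Set $\mathcal J_C[V]=\mathcal A_C(\mathcal L(U^\star V^\top+V{U^\star}^\top))$, $\mathcal J_N[V]=\mathcal A_N(\mathcal L(U^\star V^\top+V{U^\star}^\top))$, $\mathcal Q_C(V)=\mathcal A_C(\mathcal L(VV^\top))$ for $V\in\mathbb R^{n\times k}$; $\mathcal R_C=\operatorname{Im}\mathcal J_C$, $\mathcal N_C=\ker\mathcal J_C^*=\mathcal R_C^\perp\subseteq\mathbb R^{m_C}$, with orthogonal projection $P_{\mathcal N_C}$; and the clean multiplier polytope $\Lambda_C=\{v\in[-1,1]^{m_C}:\mathcal J_C^*[v]=\mathcal J_N^*[\operatorname{sign}(\varepsilon_N)]\}$. (It lies in a translate $\bar v+\mathcal N_C$.) Conditions: (I) $\Lambda_C\cap(-1,1)^{m_C}\neq\emptyset$; (N) for every vertex $\nu$ of $\Lambda_C$, with $\mathcal I_<(\nu)=\{i:|\nu_i|<1\}$, the map $\mathcal J_{C,\mathcal I_<(\nu)}$ obtained by restricting the output of $\mathcal J_C$ to coordinates in $\mathcal I_<(\nu)$ satisfies $\operatorname{rank}\mathcal J_{C,\mathcal I_<(\nu)}=\operatorname{rank}\mathcal J_C$. For a vertex $\nu$, $N^{\mathcal N_C}_{\Lambda_C}(\nu)=\{w\in\mathcal N_C:\langle w,v-\nu\rangle\le0\ \forall v\in\Lambda_C\}$ is the normal cone of $\Lambda_C$ at $\nu$ relative to $\bar v+\mathcal N_C$. Identifiability. $\partial$ is the limiting subdifferential; $\bar x$ is critical for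 $h$ if $0\in\partial h(\bar x)$. For locally Lipschitz $h$ and $\bar v\in\partial h(\bar x)$, a set $\mathcal M\ni\bar x$ is identifiable for $h$ at $\bar x$ for $\bar v$ if for all sequences $x_\nu\to\bar x$, $v_\nu\to\bar v$ with $v_\nu\in\partial h(x_\nu)$ one has $x_\nu\in\mathcal M$ for all large $\nu$. It is a $C^2$ identifiable manifold if it is identifiable and, near $\bar x$, is a $C^2$ embedded submanifold on which $h$ restricts to a $C^2$ function. A critical point is inactive if no $C^2$ identifiable manifold exists for $h$ at $\bar x$ for $0$. *)

theory Defs
  imports "HOL-Analysis.Analysis"
begin

section \<open>Variational analysis\<close>

definition regular_subdifferential :: "('a::euclidean_space \<Rightarrow> real) \<Rightarrow> 'a \<Rightarrow> 'a set" where
  "regular_subdifferential h x =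
     {v. \<forall>e>0. \<forall>\<^sub>F y in at x. h y \<ge> h x + v \<bullet> (y - x) - e * norm (y - x)}"

definition limiting_subdifferential :: "('a::euclidean_space \<Rightarrow> real) \<Rightarrow> 'a \<Rightarrow> 'a set" where
  "limiting_subdifferential h x =
     {v. \<exists>xs vs. xs \<longlonglongrightarrow> x \<and> (\<lambda>j. h (xs j)) \<longlonglongrightarrow> h x \<and> vs \<longlonglongrightarrow> v \<and>
           (\<forall>j. vs j \<in> regular_subdifferential h (xs j))}"

definition critical_point :: "('a::euclidean_space \<Rightarrow> real) \<Rightarrow> 'a \<Rightarrow> bool" where
  "critical_point h x \<longleftrightarrow> 0 \<in> limiting_subdifferential h x"

definition identifiable :: "('a::euclidean_space \<Rightarrow> real) \<Rightarrow> 'a set \<Rightarrow> 'a \<Rightarrow> 'a \<Rightarrow> bool" where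
  "identifiable h M x v \<longleftrightarrow> x \<in> M \<and>
     (\<forall>xs vs. xs \<longlonglongrightarrow> x \<longrightarrow> vs \<longlonglongrightarrow> v \<longrightarrow>
        (\<forall>j. vs j \<in> limiting_subdifferential h (xs j)) \<longrightarrow>
        (\<forall>\<^sub>F j in sequentially. xs j \<in> M))"

text \<open>Twice continuously differentiable maps on an open set.\<close>

definition C2_on :: "'a::euclidean_space set \<Rightarrow> ('a \<Rightarrow> 'b::euclidean_space) \<Rightarrow> bool" where
  "C2_on W f \<longleftrightarrow>
     (\<exists>(f' :: 'a \<Rightarrow> 'a \<Rightarrow>\<^sub>L 'b) (f'' :: 'a \<Rightarrow> 'a \<Rightarrow>\<^sub>L ('a \<Rightarrow>\<^sub>L 'b)).
        (\<forall>x\<in>W. (f has_derivative blinfun_apply (f' x)) (at x)) \<and>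
        (\<forall>x\<in>W. (f' has_derivative blinfun_apply (f'' x)) (at x)) \<and>
        continuous_on W f'')"

text \<open>
  An embedded submanifold is locally the zero set of a submersion.  The target of the submersion is
  a linear subspace \<open>S\<close> of the ambient space, so that every codimension between \<open>0\<close> and the
  dimension of the ambient space is available.
\<close>

definition C2_submanifold :: "'a::euclidean_space set \<Rightarrow> bool" where
  "C2_submanifold M \<longleftrightarrow>
     (\<forall>x\<in>M. \<exists>W S (G :: 'a \<Rightarrow> 'a).
        open W \<and> x \<in> W \<and> subspace S \<and> C2_on W G \<and> G ` W \<subseteq> S \<and>
        (\<forall>z\<in>W. range (frechet_derivative G (at z)) = S) \<and>
        M \<inter> W = {z \<in> W. G z = 0})"

definition C2_restriction :: "('a::euclidean_space \<Rightarrow> real) \<Rightarrow> 'a set \<Rightarrow> bool" where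
  "C2_restriction h M \<longleftrightarrow>
     (\<forall>x\<in>M. \<exists>W g. open W \<and> x \<in> W \<and> C2_on W g \<and> (\<forall>z\<in>M \<inter> W. g z = h z))"

definition C2_identifiable_manifold ::
    "('a::euclidean_space \<Rightarrow> real) \<Rightarrow> 'a set \<Rightarrow> 'a \<Rightarrow> 'a \<Rightarrow> bool" where
  "C2_identifiable_manifold h M x v \<longleftrightarrow> identifiable h M x v \<and>
     (\<exists>W. open W \<and> x \<in> W \<and> C2_submanifold (M \<inter> W) \<and> C2_restriction h (M \<inter> W))"

definition inactive :: "('a::euclidean_space \<Rightarrow> real) \<Rightarrow> 'a \<Rightarrow> bool" where
  "inactive h x \<longleftrightarrow> critical_point h x \<and> \<not> (\<exists>M. C2_identifiable_manifold h M x 0)"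

section \<open>Linear algebra and cones\<close>

definition orth_proj :: "'a::euclidean_space set \<Rightarrow> 'a \<Rightarrow> 'a" where
  "orth_proj S x = (THE p. p \<in> S \<and> (\<forall>s\<in>S. (x - p) \<bullet> s = 0))"

definition sym_mat :: "real^'n^'n \<Rightarrow> bool" where
  "sym_mat Z \<longleftrightarrow> transpose Z = Z"

definition psd_mat :: "real^'n^'n \<Rightarrow> bool" where
  "psd_mat Z \<longleftrightarrow> sym_mat Z \<and> (\<forall>z. z \<bullet> (Z *v z) \<ge> 0)"

text \<open>A linear map of the space of symmetric matrices; its values elsewhere are irrelevant.\<close>

definition linear_on_sym :: "(real^'n^'n \<Rightarrow> real^'n^'n) \<Rightarrow> bool" where
  "linear_on_sym L \<longleftrightarrow>
     (\<forall>Z. sym_mat Z \<longrightarrow> sym_mat (L Z)) \<and>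
     (\<forall>Y Z. sym_mat Y \<longrightarrow> sym_mat Z \<longrightarrow> L (Y + Z) = L Y + L Z) \<and>
     (\<forall>c Z. sym_mat Z \<longrightarrow> L (c *\<^sub>R Z) = c *\<^sub>R L Z)"

text \<open>
  Only positive multiples are required: the library predicate \<^const>\<open>cone\<close> forces \<open>0 \<in> C\<close>, and
  then a relatively open cone in a subspace would be the whole subspace.
\<close>

definition rel_open_cone :: "'a::euclidean_space set \<Rightarrow> 'a set \<Rightarrow> bool" where
  "rel_open_cone W C \<longleftrightarrow>
     openin (top_of_set W) C \<and> (\<forall>x\<in>C. \<forall>t>0. t *\<^sub>R x \<in> C)"

section \<open>Robust low-rank recovery\<close>

text \<open>
  For \<open>I\<close> a set of coordinates of \<^typ>\<open>real^'m\<close>, the space of vectors indexed by \<open>I\<close> is represented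
  by the vectors supported on \<open>I\<close> (an isometric copy), and restriction to the coordinates in \<open>I\<close> by
  setting the other coordinates to zero.
\<close>

definition coord_space :: "'m set \<Rightarrow> (real^'m) set" where
  "coord_space I = {v. \<forall>i. i \<notin> I \<longrightarrow> v $ i = 0}"

definition restr :: "'m set \<Rightarrow> real^'m \<Rightarrow> real^'m" where
  "restr I v = (\<chi> i. if i \<in> I then v $ i else 0)"

definition meas :: "('m \<Rightarrow> real^'n^'n) \<Rightarrow> real^'n^'n \<Rightarrow> real^'m" where
  "meas A Z = (\<chi> i. A i \<bullet> Z)"

definition f_LR :: "('m::finite \<Rightarrow> real^'n^'n) \<Rightarrow> (real^'n^'n \<Rightarrow> real^'n^'n) \<Rightarrow> real^'m
    \<Rightarrow> real^'k^'n \<Rightarrow> real" where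
  "f_LR A L y U = (\<Sum>i\<in>UNIV. \<bar>(meas A (L (U ** transpose U)) - y) $ i\<bar>)"

definition Omega_C :: "real^'m \<Rightarrow> 'm set" where
  "Omega_C \<epsilon> = {i. \<epsilon> $ i = 0}"

definition Omega_N :: "real^'m \<Rightarrow> 'm set" where
  "Omega_N \<epsilon> = {i. \<epsilon> $ i \<noteq> 0}"

definition J_C :: "('m \<Rightarrow> real^'n^'n) \<Rightarrow> (real^'n^'n \<Rightarrow> real^'n^'n) \<Rightarrow> real^'m \<Rightarrow> real^'k^'n
    \<Rightarrow> real^'k^'n \<Rightarrow> real^'m" where
  "J_C A L \<epsilon> U V = restr (Omega_C \<epsilon>) (meas A (L (U ** transpose V + V ** transpose U)))"

definition J_N :: "('m \<Rightarrow> real^'n^'n) \<Rightarrow> (real^'n^'n \<Rightarrow> real^'n^'n) \<Rightarrow> real^'m \<Rightarrow> real^'k^'n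
    \<Rightarrow> real^'k^'n \<Rightarrow> real^'m" where
  "J_N A L \<epsilon> U V = restr (Omega_N \<epsilon>) (meas A (L (U ** transpose V + V ** transpose U)))"

definition Q_C :: "('m \<Rightarrow> real^'n^'n) \<Rightarrow> (real^'n^'n \<Rightarrow> real^'n^'n) \<Rightarrow> real^'m
    \<Rightarrow> real^'k^'n \<Rightarrow> real^'m" where
  "Q_C A L \<epsilon> V = restr (Omega_C \<epsilon>) (meas A (L (V ** transpose V)))"

definition N_C :: "('m::finite \<Rightarrow> real^'n^'n) \<Rightarrow> (real^'n^'n \<Rightarrow> real^'n^'n) \<Rightarrow> real^'m
    \<Rightarrow> real^'k^'n \<Rightarrow> (real^'m) set" where
  "N_C A L \<epsilon> U = {v \<in> coord_space (Omega_C \<epsilon>). adjoint (J_C A L \<epsilon> U) v = 0}"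

definition Lambda_C :: "('m::finite \<Rightarrow> real^'n^'n) \<Rightarrow> (real^'n^'n \<Rightarrow> real^'n^'n) \<Rightarrow> real^'m
    \<Rightarrow> real^'k^'n \<Rightarrow> (real^'m) set" where
  "Lambda_C A L \<epsilon> U =
     {v \<in> coord_space (Omega_C \<epsilon>).
        (\<forall>i\<in>Omega_C \<epsilon>. -1 \<le> v $ i \<and> v $ i \<le> 1) \<and>
        adjoint (J_C A L \<epsilon> U) v =
          adjoint (J_N A L \<epsilon> U) (restr (Omega_N \<epsilon>) (\<chi> i. sgn (\<epsilon> $ i)))}"

definition condition_I :: "('m::finite \<Rightarrow> real^'n^'n) \<Rightarrow> (real^'n^'n \<Rightarrow> real^'n^'n) \<Rightarrow> real^'m
    \<Rightarrow> real^'k^'n \<Rightarrow> bool" where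
  "condition_I A L \<epsilon> U \<longleftrightarrow>
     (\<exists>v\<in>Lambda_C A L \<epsilon> U. \<forall>i\<in>Omega_C \<epsilon>. -1 < v $ i \<and> v $ i < 1)"

definition I_less :: "real^'m \<Rightarrow> real^'m \<Rightarrow> 'm set" where
  "I_less \<epsilon> \<nu> = {i \<in> Omega_C \<epsilon>. \<bar>\<nu> $ i\<bar> < 1}"

text \<open>The vertices of the polytope are its extreme points; the rank of a linear map is the
  dimension of its range.\<close>

definition condition_N :: "('m::finite \<Rightarrow> real^'n^'n) \<Rightarrow> (real^'n^'n \<Rightarrow> real^'n^'n) \<Rightarrow> real^'m
    \<Rightarrow> real^'k^'n \<Rightarrow> bool" where
  "condition_N A L \<epsilon> U \<longleftrightarrow>
     (\<forall>\<nu>. \<nu> extreme_point_of Lambda_C A L \<epsilon> U \<longrightarrow>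
        dim (range (\<lambda>V. restr (I_less \<epsilon> \<nu>) (J_C A L \<epsilon> U V))) = dim (range (J_C A L \<epsilon> U)))"

definition rel_normal_cone :: "('m::finite \<Rightarrow> real^'n^'n) \<Rightarrow> (real^'n^'n \<Rightarrow> real^'n^'n) \<Rightarrow> real^'m
    \<Rightarrow> real^'k^'n \<Rightarrow> real^'m \<Rightarrow> (real^'m) set" where
  "rel_normal_cone A L \<epsilon> U \<nu> =
     {w \<in> N_C A L \<epsilon> U. \<forall>v\<in>Lambda_C A L \<epsilon> U. w \<bullet> (v - \<nu>) \<le> 0}"

end

theory Submission
  imports Defs
begin

text \<open>
  Write the loss near \<open>U\<close> as \<open>f (U + V) = \<parallel>J V + B V V - \<epsilon>\<parallel>\<^sub>1\<close> with \<open>J\<close> linear and \<open>B\<close> bilinear.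
  A point \<open>\<nu>\<close> of the clean multiplier polytope, completed by \<open>- sgn \<epsilon>\<close> on the noisy coordinates, is a
  vector \<open>\<sigma>\<close> with entries in \<open>[-1, 1]\<close> that annihilates the range of \<open>J\<close>.
  Pairing with \<open>\<sigma>\<close> yields the global minorant
  \<open>f (U + V) \<ge> f U + \<sigma> \<bullet> B V V\<close>, with equality precisely where \<open>\<sigma>\<close> is consistent with the signs of the
  residual (\<open>multiplier_minorant\<close>, \<open>multiplier_exact\<close>).  Where equality holds, the gradient of
  the minorant is a subgradient of \<open>f\<close>, and it tends to \<open>0\<close> as \<open>V \<longlonglongrightarrow> 0\<close>.

  For a vertex \<open>\<nu>\<close> and \<open>V\<close> in its cone, points of equality exist along a curve tangent to \<open>V\<close>
  (\<open>sign_consistent_sequence\<close>).  The coordinates with \<open>\<bar>\<nu> $ i\<bar> < 1\<close> must have zero residual; being a vertex makes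
  these equations a submersion, so they can be solved exactly.  The remaining clean coordinates must
  have residuals of the sign of \<open>\<nu> $ i\<close>, and this is what membership of the projected curvature
  in the relative interior of the normal cone provides, thanks to the rank condition
  (\<open>vertex_correction\<close>).

  A \<open>C\<^sup>2\<close> identifiable manifold must eventually contain all these near-critical points.  Since \<open>f\<close> is
  \<open>C\<^sup>2\<close> along the manifold and its tangential derivative at \<open>U\<close> vanishes, there is one quadratic
  form giving the second-order growth of \<open>f\<close> along every near-critical sequence
  (\<open>identifiable_manifold_second_order_form\<close>).  It equals \<open>\<sigma>1 \<bullet> B V V\<close> on the first cone and
  \<open>\<sigma>2 \<bullet> B V V\<close> on the second.  Both cones are relatively open in \<open>W\<close>, so the two forms agree on all
  of \<open>W\<close>.  But for \<open>V\<close> in the first cone the curvature lies in the relative interior of the normal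
  cone of \<open>\<nu>1\<close>, which makes \<open>\<nu>1\<close> pair strictly higher with it than \<open>\<nu>2\<close>
  (\<open>relint_ncone_separates\<close>), a contradiction.
\<close>

section \<open>Solving equations near a point of strict differentiability\<close>

text \<open>
  Strict differentiability bounds the linearisation error between any two nearby points, not only
  between \<open>x\<close> and a nearby point.  That uniformity is what makes the correction map in
  \<open>metric_regularity\<close> a contraction.
\<close>

definition strict_derivative ::
    "('a::euclidean_space \<Rightarrow> 'b::euclidean_space) \<Rightarrow> ('a \<Rightarrow> 'b) \<Rightarrow> 'a \<Rightarrow> bool" where
  "strict_derivative G D x \<longleftrightarrow> linear D \<and>
     (\<forall>e>0. \<exists>d>0. \<forall>a\<in>ball x d. \<forall>b\<in>ball x d. norm (G a - G b - D (a - b)) \<le> e * norm (a - b))"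

lemma C2_on_strict_derivative:
  fixes G :: "'a::euclidean_space \<Rightarrow> 'b::euclidean_space"
  assumes "C2_on W G" "open W" "x \<in> W"
  shows "strict_derivative G (frechet_derivative G (at x)) x"
proof -
  obtain G' :: "'a \<Rightarrow> 'a \<Rightarrow>\<^sub>L 'b" and G'' where
    G': "\<And>z. z \<in> W \<Longrightarrow> (G has_derivative blinfun_apply (G' z)) (at z)" and
    G'': "\<And>z. z \<in> W \<Longrightarrow> (G' has_derivative blinfun_apply (G'' z)) (at z)"
    using assms(1) unfolding C2_on_def by metis
  have D: "frechet_derivative G (at x) = blinfun_apply (G' x)"
    using frechet_derivative_at[OF G'[OF assms(3)]] by simp
  have "\<exists>d>0. \<forall>a\<in>ball x d. \<forall>b\<in>ball x d.
      norm (G a - G b - G' x (a - b)) \<le> e * norm (a - b)" if "e > 0" for e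
  proof -
    have "isCont G' x" using G''[OF assms(3)] by (rule has_derivative_continuous)
    then obtain d1 where d1: "d1 > 0" "\<And>z. dist z x < d1 \<Longrightarrow> dist (G' z) (G' x) < e"
      using \<open>e > 0\<close> unfolding continuous_at_eps_delta by meson
    obtain d2 where d2: "d2 > 0" "ball x d2 \<subseteq> W"
      using assms(2,3) open_contains_ball by blast
    define d where "d = min d1 d2"
    have "norm (G a - G b - G' x (a - b)) \<le> e * norm (a - b)"
      if "a \<in> ball x d" "b \<in> ball x d" for a b
    proof -
      have "norm (G a - G b - G' x (a - b)) \<le> norm (a - b) * e"
      proof (rule differentiable_bound_linearization[where S="ball x d" and f'="\<lambda>z. blinfun_apply (G' z)"])
        show "b + t *\<^sub>R (a - b) \<in> ball x d" if "t \<in> {0..1}" for t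
        proof -
          have "b + t *\<^sub>R (a - b) = (1 - t) *\<^sub>R b + t *\<^sub>R a"
            by (simp add: scaleR_diff_left scaleR_diff_right)
          then show ?thesis
            using convexD_alt[OF convex_ball \<open>b \<in> ball x d\<close> \<open>a \<in> ball x d\<close>, of t] that
            by (simp only: atLeastAtMost_iff)
        qed
        show "(G has_derivative blinfun_apply (G' z)) (at z within ball x d)" if "z \<in> ball x d" for z
        proof -
          have "z \<in> W" using that d2(2) by (auto simp: d_def)
          then show ?thesis by (rule has_derivative_at_withinI[OF G'])
        qed
        show "onorm (blinfun_apply (G' z) - blinfun_apply (G' x)) \<le> e" if "z \<in> ball x d" for z
        proof -
          have "dist z x < d1" using that by (simp add: d_def dist_commute)
          then have "norm (G' z - G' x) < e" using d1(2) by (simp add: dist_norm)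
          moreover have "blinfun_apply (G' z) - blinfun_apply (G' x) = blinfun_apply (G' z - G' x)"
            by (simp add: fun_eq_iff blinfun.diff_left)
          ultimately show ?thesis by (simp add: norm_blinfun.rep_eq)
        qed
        show "x \<in> ball x d" using d1 d2 by (simp add: d_def)
      qed
      then show ?thesis by (simp add: mult.commute)
    qed
    moreover have "d > 0" using d1 d2 by (simp add: d_def)
    ultimately show ?thesis by blast
  qed
  moreover have "linear (blinfun_apply (G' x))"
    by (rule bounded_linear.linear[OF blinfun.bounded_linear_right])
  ultimately show ?thesis unfolding strict_derivative_def D by blast
qed

text \<open>
  The Lyusternik--Graves theorem in the form needed for constraints \<open>G z = 0\<close>: an approximate
  solution can be moved to an exact one at a cost proportional to its residual.  With a right inverse
  \<open>R\<close> of \<open>D\<close> on \<open>S\<close>, a zero of \<open>G\<close> of the form \<open>z + R s\<close> is a fixed point of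
  \<open>s \<mapsto> s - G (z + R s)\<close>.  Strict differentiability makes this map a contraction with factor
  one half, and it maps the ball of radius \<open>2 * norm (G z)\<close> in \<open>S\<close> into itself.
\<close>

lemma metric_regularity:
  fixes G :: "'a::euclidean_space \<Rightarrow> 'b::euclidean_space"
  assumes strict: "strict_derivative G D x" and S: "subspace S" "S \<subseteq> range D"
    and Gx: "G x = 0" and r: "r > 0" "\<And>z. z \<in> ball x r \<Longrightarrow> G z \<in> S"
  obtains K d where "K > 0" "d > 0"
    "\<And>z. z \<in> ball x d \<Longrightarrow> \<exists>z'\<in>ball x r. G z' = 0 \<and> norm (z' - z) \<le> K * norm (G z)"
proof -
  have lD: "linear D" using strict by (simp add: strict_derivative_def)
  obtain R where R: "linear R" "\<And>s. s \<in> S \<Longrightarrow> D (R s) = s"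
    using linear_exists_right_inverse_on[OF lD subspace_UNIV] S by blast
  obtain k where k: "k > 0" "\<And>s. norm (R s) \<le> k * norm s"
    using linear_bounded_pos[OF R(1)] by (metis mult.commute)
  obtain c where c: "c > 0" "\<And>s. norm (D s) \<le> c * norm s"
    using linear_bounded_pos[OF lD] by (metis mult.commute)
  \<comment> \<open>This error level turns the Lipschitz constant \<open>e * k\<close> of the correction map into one half.\<close>
  define e where "e = 1 / (2 * k)"
  have e: "e > 0" using k by (simp add: e_def)
  then obtain d0 where d0: "d0 > 0"
    "\<And>a b. a \<in> ball x d0 \<Longrightarrow> b \<in> ball x d0 \<Longrightarrow> norm (G a - G b - D (a - b)) \<le> e * norm (a - b)"
    using strict unfolding strict_derivative_def by meson
  define q where "q = min d0 r"
  have q: "q > 0" "q \<le> d0" "q \<le> r" using d0 r by (auto simp: q_def)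
  \<comment> \<open>The residual is at most \<open>(c + e) * d\<close> on \<open>ball x d\<close>, so corrections have norm at most
      \<open>2 * k * (c + e) * d\<close>, and \<open>d\<close> is chosen to keep the corrected points within \<open>ball x q\<close>.\<close>
  define d where "d = q / (1 + 2 * k * (c + e))"
  have pos: "1 + 2 * k * (c + e) > 1" using k c e by simp
  have d: "d > 0" using q pos by (simp add: d_def)
  have dq: "d + 2 * k * (c + e) * d = q"
  proof -
    have "d + 2 * k * (c + e) * d = d * (1 + 2 * k * (c + e))" by (simp add: algebra_simps)
    then show ?thesis using pos by (simp add: d_def)
  qed
  moreover have "2 * k * (c + e) * d \<ge> 0" using k c e d by simp
  ultimately have "d \<le> q" by linarith
  have main: "\<exists>z'\<in>ball x r. G z' = 0 \<and> norm (z' - z) \<le> (2 * k) * norm (G z)"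
    if z: "z \<in> ball x d" for z
  proof -
    have nz: "norm (z - x) < d" using z by (simp add: dist_norm norm_minus_commute)
    have "norm (G z - G x - D (z - x)) \<le> e * norm (z - x)"
      using d0(2)[of z x] z \<open>d \<le> q\<close> q by auto
    then have "norm (G z) \<le> e * norm (z - x) + norm (D (z - x))"
      using Gx norm_triangle_sub[of "G z" "D (z - x)"] by simp
    also have "\<dots> \<le> (c + e) * norm (z - x)" using c(2)[of "z - x"] by (simp add: algebra_simps)
    also have "\<dots> \<le> (c + e) * d" using nz c e by (intro mult_left_mono) auto
    finally have Gz: "norm (G z) \<le> (c + e) * d" .
    define T where "T = cball 0 (2 * norm (G z)) \<inter> S"
    have inball: "z + R s \<in> ball x q" if "s \<in> T" for s
    proof -
      have "norm (R s) \<le> k * norm s" by (rule k)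
      also have "\<dots> \<le> k * (2 * ((c + e) * d))" using that Gz k by (intro mult_left_mono) (auto simp: T_def)
      finally have "norm (R s) \<le> 2 * k * (c + e) * d" by (simp add: algebra_simps)
      moreover have "norm (z + R s - x) \<le> norm (z - x) + norm (R s)"
        using norm_triangle_ineq[of "z - x" "R s"] by (simp add: algebra_simps)
      ultimately have "norm (z + R s - x) < q" using nz dq by linarith
      then show ?thesis by (simp add: dist_norm norm_minus_commute)
    qed
    define \<phi> where "\<phi> s = s - G (z + R s)" for s
    have contr: "norm (\<phi> s - \<phi> s') \<le> 1/2 * norm (s - s')" if "s \<in> T" "s' \<in> T" for s s'
    proof -
      have ss: "s - s' \<in> S" using that S by (auto simp: T_def intro: subspace_diff)
      have eq: "(z + R s) - (z + R s') = R (s - s')" by (simp add: linear_diff[OF R(1)])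
      have "norm (G (z + R s) - G (z + R s') - D ((z + R s) - (z + R s'))) \<le> e * norm ((z + R s) - (z + R s'))"
        using inball[OF that(1)] inball[OF that(2)] q by (intro d0(2)) auto
      then have "norm (G (z + R s) - G (z + R s') - (s - s')) \<le> e * norm (R (s - s'))"
        unfolding eq R(2)[OF ss] .
      also have "\<dots> \<le> e * (k * norm (s - s'))" using e k(2) by (intro mult_left_mono) auto
      also have "\<dots> = 1/2 * norm (s - s')" using k by (simp add: e_def)
      finally have "norm (G (z + R s) - G (z + R s') - (s - s')) \<le> 1/2 * norm (s - s')" .
      moreover have "\<phi> s - \<phi> s' = - (G (z + R s) - G (z + R s') - (s - s'))"
        by (simp add: \<phi>_def)
      ultimately show ?thesis by (simp only: norm_minus_cancel)
    qed
    have T0: "0 \<in> T" using S by (auto simp: T_def subspace_0)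
    have "\<exists>!s\<in>T. \<phi> s = s"
    proof (rule Banach_fix[where c="1/2"])
      have "closed T" unfolding T_def using closed_Int[OF closed_cball closed_subspace[OF S(1)]] .
      then show "complete T" by (simp add: complete_eq_closed)
      show "\<phi> ` T \<subseteq> T"
      proof
        fix w assume "w \<in> \<phi> ` T"
        then obtain s where s: "s \<in> T" "w = \<phi> s" by auto
        have "\<phi> 0 = - G z" by (simp add: \<phi>_def linear_0[OF R(1)])
        then have "norm (\<phi> s) \<le> 1/2 * norm s + norm (G z)"
          using contr[OF s(1) T0] norm_triangle_sub[of "\<phi> s" "\<phi> 0"] by simp
        then have "norm w \<le> 2 * norm (G z)" using s by (auto simp: T_def)
        moreover have "z + R s \<in> ball x r" using inball[OF s(1)] q by auto
        then have "w \<in> S"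
          using subspace_diff[OF S(1) _ r(2)] s by (simp add: \<phi>_def T_def)
        ultimately show "w \<in> T" by (simp add: T_def)
      qed
      show "T \<noteq> {}" using T0 by blast
      show "dist (\<phi> s) (\<phi> s') \<le> 1/2 * dist s s'" if "s \<in> T" "s' \<in> T" for s s'
        using contr[OF that] by (simp only: dist_norm)
    qed simp_all
    then obtain s where s: "s \<in> T" "\<phi> s = s" by blast
    have "norm (R s) \<le> k * (2 * norm (G z))"
    proof (rule order_trans[OF k(2)])
      show "k * norm s \<le> k * (2 * norm (G z))"
        using s(1) k(1) by (intro mult_left_mono) (auto simp: T_def)
    qed
    moreover have "G (z + R s) = 0" using s(2) by (simp add: \<phi>_def)
    moreover have "z + R s \<in> ball x r" using inball[OF s(1)] q by auto
    ultimately show ?thesis by (intro bexI[of _ "z + R s"]) simp_all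
  qed
  show ?thesis by (rule that[OF _ d main]) (use k in auto)
qed

text \<open>
  Every kernel direction of \<open>D\<close> is tangent to the zero set: the residual at \<open>x + t *\<^sub>R d\<close> is \<open>o(t)\<close>,
  so \<open>metric_regularity\<close> moves this point onto the zero set by \<open>o(t)\<close>.
\<close>

lemma tangent_sequence:
  fixes G :: "'a::euclidean_space \<Rightarrow> 'b::euclidean_space"
  assumes strict: "strict_derivative G D x" and S: "subspace S" "S \<subseteq> range D"
    and Gx: "G x = 0" and r: "r > 0" "\<And>z. z \<in> ball x r \<Longrightarrow> G z \<in> S"
    and d: "D d = 0"
  obtains t zs where "\<And>n. t n > (0::real)" "t \<longlonglongrightarrow> 0" "\<And>n. zs n \<in> ball x r" "\<And>n. G (zs n) = 0"
    "(\<lambda>n. (zs n - x) /\<^sub>R t n) \<longlonglongrightarrow> d"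
proof -
  obtain K \<delta> where K: "K > 0" "\<delta> > 0"
    "\<And>z. z \<in> ball x \<delta> \<Longrightarrow> \<exists>z'\<in>ball x r. G z' = 0 \<and> norm (z' - z) \<le> K * norm (G z)"
    using metric_regularity[OF strict S Gx r] by blast
  define N where "N = norm d + 1"
  have N: "N > 0" by (simp add: N_def add_nonneg_pos)
  have step: "\<exists>t z. 0 < t \<and> t < e \<and> z \<in> ball x r \<and> G z = 0 \<and> norm ((z - x) /\<^sub>R t - d) < e"
    if e: "e > 0" for e :: real
  proof -
    define \<eta> where "\<eta> = e / (2 * K * N)"
    have \<eta>: "\<eta> > 0" using e K N by (simp add: \<eta>_def)
    obtain d1 where d1: "d1 > 0"
      "\<And>a b. a \<in> ball x d1 \<Longrightarrow> b \<in> ball x d1 \<Longrightarrow> norm (G a - G b - D (a - b)) \<le> \<eta> * norm (a - b)"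
      using strict \<eta> unfolding strict_derivative_def by meson
    define \<tau> where "\<tau> = min e (min (\<delta> / N) (d1 / N))"
    define t where "t = \<tau> / 2"
    have "\<tau> > 0" "\<tau> \<le> e" "\<tau> \<le> \<delta> / N" "\<tau> \<le> d1 / N" using e K d1 N by (auto simp: \<tau>_def)
    moreover have "t > 0" "t < \<tau>" using \<open>\<tau> > 0\<close> by (simp_all add: t_def)
    ultimately have t: "t > 0" "t < e" "t < \<delta> / N" "t < d1 / N"
      by (blast intro: less_le_trans)+
    then have tN: "t * N < \<delta>" "t * N < d1" using N by (auto simp: field_simps)
    have "norm (t *\<^sub>R d) \<le> t * N" using t by (simp add: N_def)
    then have zin: "x + t *\<^sub>R d \<in> ball x \<delta>" "x + t *\<^sub>R d \<in> ball x d1"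
      using tN by (auto simp: dist_norm)
    obtain z where z: "z \<in> ball x r" "G z = 0"
      "norm (z - (x + t *\<^sub>R d)) \<le> K * norm (G (x + t *\<^sub>R d))"
      using K(3)[OF zin(1)] by blast
    have "linear D" using strict by (simp add: strict_derivative_def)
    then have "D (t *\<^sub>R d) = 0" using d by (simp add: linear_cmul)
    then have "norm (G (x + t *\<^sub>R d)) \<le> \<eta> * norm (t *\<^sub>R d)"
      using d1(2)[OF zin(2), of x] d1(1) Gx by simp
    also have "\<dots> \<le> \<eta> * (t * N)" using \<eta> t by (intro mult_left_mono) (auto simp: N_def)
    finally have "norm (z - (x + t *\<^sub>R d)) \<le> K * (\<eta> * (t * N))"
      using z(3) K(1) by (meson dual_order.trans less_imp_le mult_left_mono)
    also have "\<dots> = t * (e / 2)" using K N by (simp add: \<eta>_def)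
    finally have b: "norm (z - (x + t *\<^sub>R d)) \<le> t * (e / 2)" .
    have "(z - x) /\<^sub>R t - d = (z - (x + t *\<^sub>R d)) /\<^sub>R t" using t by (simp add: algebra_simps)
    then have "norm ((z - x) /\<^sub>R t - d) = norm (z - (x + t *\<^sub>R d)) / t"
      using t by (simp add: divide_inverse mult.commute)
    also have "\<dots> \<le> e / 2" using b t by (simp add: field_simps)
    also have "\<dots> < e" using e by simp
    finally show ?thesis using t z by blast
  qed
  have "\<forall>n. \<exists>t z. 0 < t \<and> t < inverse (real (Suc n)) \<and> z \<in> ball x r \<and> G z = 0 \<and>
      norm ((z - x) /\<^sub>R t - d) < inverse (real (Suc n))"
    using step by simp
  then obtain t zs where tz: "\<And>n. 0 < t n" "\<And>n. t n < inverse (real (Suc n))"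
    "\<And>n. zs n \<in> ball x r" "\<And>n. G (zs n) = 0"
    "\<And>n. norm ((zs n - x) /\<^sub>R t n - d) < inverse (real (Suc n))"
    by metis
  have "t \<longlonglongrightarrow> 0"
    using tz(1,2) by (intro tendsto_sandwich[OF _ _ tendsto_const LIMSEQ_inverse_real_of_nat])
      (auto intro!: always_eventually less_imp_le)
  moreover have "(\<lambda>n. (zs n - x) /\<^sub>R t n - d) \<longlonglongrightarrow> 0"
    using tz(5) by (intro Lim_null_comparison[OF _ LIMSEQ_inverse_real_of_nat])
      (auto intro!: always_eventually less_imp_le)
  then have "(\<lambda>n. (zs n - x) /\<^sub>R t n) \<longlonglongrightarrow> d" by (simp add: LIM_zero_iff)
  ultimately show ?thesis by (intro that[OF tz(1) _ tz(3) tz(4)])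
qed

section \<open>The second-order form of an identifiable manifold\<close>

lemma strict_derivative_imp_has_derivative:
  assumes "strict_derivative G D x"
  shows "(G has_derivative D) (at x)"
proof -
  have "\<exists>d>0. \<forall>y. norm (y - x) < d \<longrightarrow> norm (G y - G x - D (y - x)) \<le> e * norm (y - x)"
    if "e > 0" for e :: real
  proof -
    have "\<exists>d>0. \<forall>a\<in>ball x d. \<forall>b\<in>ball x d. norm (G a - G b - D (a - b)) \<le> e * norm (a - b)"
      using assms that by (simp only: strict_derivative_def)
    then obtain d where d: "d > 0"
      "\<forall>a\<in>ball x d. \<forall>b\<in>ball x d. norm (G a - G b - D (a - b)) \<le> e * norm (a - b)"
      by blast
    then have "norm (G y - G x - D (y - x)) \<le> e * norm (y - x)" if "norm (y - x) < d" for y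
    proof -
      have "y \<in> ball x d" "x \<in> ball x d" using that d(1) by (simp_all add: dist_norm norm_minus_commute)
      then show ?thesis using d(2) by blast
    qed
    with d(1) show ?thesis by blast
  qed
  moreover have "bounded_linear D"
    using assms by (simp add: strict_derivative_def linear_conv_bounded_linear)
  ultimately show ?thesis by (simp add: has_derivative_at_alt)
qed

lemma tendsto_of_difference_quotients:
  fixes x :: "'a::real_normed_vector"
  assumes "\<And>n. t n > (0::real)" "t \<longlonglongrightarrow> 0" "(\<lambda>n. (xs n - x) /\<^sub>R t n) \<longlonglongrightarrow> V"
  shows "xs \<longlonglongrightarrow> x"
proof -
  have "(\<lambda>n. t n *\<^sub>R ((xs n - x) /\<^sub>R t n)) \<longlonglongrightarrow> 0 *\<^sub>R V"
    by (intro tendsto_scaleR assms)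
  moreover have "(\<lambda>n. t n *\<^sub>R ((xs n - x) /\<^sub>R t n)) = (\<lambda>n. xs n - x)"
    using assms(1) by (auto simp: fun_eq_iff less_imp_neq[symmetric])
  ultimately show ?thesis by (simp add: LIM_zero_iff)
qed

lemma directional_difference_quotients:
  fixes G :: "'a::euclidean_space \<Rightarrow> 'b::euclidean_space"
  assumes "strict_derivative G D x"
    and t: "\<And>n. t n > (0::real)" "t \<longlonglongrightarrow> 0" "(\<lambda>n. (xs n - x) /\<^sub>R t n) \<longlonglongrightarrow> d"
  shows "(\<lambda>n. (G (xs n) - G x) /\<^sub>R t n) \<longlonglongrightarrow> D d"
proof -
  let ?u = "\<lambda>n. (xs n - x) /\<^sub>R t n"
  have lin: "linear D" using assms(1) by (simp add: strict_derivative_def)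
  have "(\<lambda>n. D (?u n)) \<longlonglongrightarrow> D d"
    using t(3) linear_continuous_at[of D] lin
    by (intro isCont_tendsto_compose[of _ D]) (simp_all add: linear_conv_bounded_linear)
  moreover have "(\<lambda>n. (G (xs n) - G x) /\<^sub>R t n - D (?u n)) \<longlonglongrightarrow> 0"
  proof (rule LIMSEQ_I)
    fix e :: real assume e: "e > 0"
    define N where "N = norm d + 1"
    have N: "N > 0" by (simp add: N_def add_nonneg_pos)
    have "e / (2 * N) > 0" using e N by simp
    then obtain \<delta> where \<delta>: "\<delta> > 0"
      "\<And>a b. a \<in> ball x \<delta> \<Longrightarrow> b \<in> ball x \<delta> \<Longrightarrow> norm (G a - G b - D (a - b)) \<le> e / (2 * N) * norm (a - b)"
      using assms(1) unfolding strict_derivative_def by meson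
    have xs: "xs \<longlonglongrightarrow> x" by (rule tendsto_of_difference_quotients[OF t])
    have "\<forall>\<^sub>F n in sequentially. dist (xs n) x < \<delta>" by (rule tendstoD[OF xs \<delta>(1)])
    moreover have "\<forall>\<^sub>F n in sequentially. norm (?u n) < N"
      using order_tendstoD(2)[OF tendsto_norm[OF t(3)], of N] by (simp add: N_def)
    ultimately have "\<forall>\<^sub>F n in sequentially. norm ((G (xs n) - G x) /\<^sub>R t n - D (?u n) - 0) < e"
    proof eventually_elim
      case (elim n)
      have "norm (G (xs n) - G x - D (xs n - x)) \<le> e / (2 * N) * norm (xs n - x)"
        using \<delta>(2)[of "xs n" x] elim(1) \<delta>(1) by (simp add: dist_commute)
      then have "norm (G (xs n) - G x - D (xs n - x)) / t n \<le> e / (2 * N) * norm (xs n - x) / t n"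
        using t(1)[of n] by (intro divide_right_mono) auto
      moreover have "norm (xs n - x) / t n = norm (?u n)"
        using t(1)[of n] by (simp add: divide_inverse_commute)
      ultimately have "norm (G (xs n) - G x - D (xs n - x)) / t n \<le> e / (2 * N) * norm (?u n)"
        by (simp only: times_divide_eq_right[symmetric])
      also have "\<dots> < e / (2 * N) * (N + N)"
      proof (rule mult_strict_left_mono)
        show "norm (?u n) < N + N" using elim(2) N by linarith
        show "0 < e / (2 * N)" using e N by simp
      qed
      also have "\<dots> = e" using N by simp
      finally have "norm (G (xs n) - G x - D (xs n - x)) / t n < e" .
      moreover have "D (?u n) = D (xs n - x) /\<^sub>R t n" by (rule linear_cmul[OF lin])
      then have "(G (xs n) - G x) /\<^sub>R t n - D (?u n) = (G (xs n) - G x - D (xs n - x)) /\<^sub>R t n"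
        by (simp only: scaleR_diff_right)
      then have "norm ((G (xs n) - G x) /\<^sub>R t n - D (?u n) - 0) = norm (G (xs n) - G x - D (xs n - x)) / t n"
        using t(1)[of n] by (simp only: diff_zero norm_scaleR) (simp add: divide_inverse_commute)
      ultimately show ?case by (simp only:)
    qed
    then show "\<exists>no. \<forall>n\<ge>no. norm ((G (xs n) - G x) /\<^sub>R t n - D (?u n) - 0) < e"
      by (simp add: eventually_sequentially)
  qed
  ultimately show ?thesis by (rule Lim_transform)
qed

lemma C2_on_subset: "C2_on W f \<Longrightarrow> W' \<subseteq> W \<Longrightarrow> C2_on W' f"
  unfolding C2_on_def by (meson continuous_on_subset subsetD)

text \<open>
  Subtracting a linear image of the constraint map leaves a function unchanged on the zero set of
  \<open>G\<close>; this lemma keeps such a Lagrangian twice continuously differentiable.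
\<close>

lemma C2_on_diff_linear:
  fixes g :: "'a::euclidean_space \<Rightarrow> 'c::euclidean_space" and G :: "'a \<Rightarrow> 'b::euclidean_space"
    and T :: "'b \<Rightarrow>\<^sub>L 'c"
  assumes "C2_on W g" "C2_on W G"
  shows "C2_on W (\<lambda>z. g z - T (G z))"
proof -
  obtain g' :: "'a \<Rightarrow> 'a \<Rightarrow>\<^sub>L 'c" and g'' where
    g: "\<forall>x\<in>W. (g has_derivative blinfun_apply (g' x)) (at x)"
    "\<forall>x\<in>W. (g' has_derivative blinfun_apply (g'' x)) (at x)" "continuous_on W g''"
    using assms(1) unfolding C2_on_def by metis
  obtain G' :: "'a \<Rightarrow> 'a \<Rightarrow>\<^sub>L 'b" and G'' where
    G: "\<forall>x\<in>W. (G has_derivative blinfun_apply (G' x)) (at x)"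
    "\<forall>x\<in>W. (G' has_derivative blinfun_apply (G'' x)) (at x)" "continuous_on W G''"
    using assms(2) unfolding C2_on_def by metis
  define C where "C = Blinfun (\<lambda>A :: 'a \<Rightarrow>\<^sub>L 'b. T o\<^sub>L A)"
  have blC: "bounded_linear (\<lambda>A :: 'a \<Rightarrow>\<^sub>L 'b. T o\<^sub>L A)"
    by (rule bounded_bilinear.bounded_linear_right[OF bounded_bilinear_blinfun_compose])
  then have C: "C A = T o\<^sub>L A" for A unfolding C_def by (simp add: bounded_linear_Blinfun_apply)
  show ?thesis
    unfolding C2_on_def
  proof (intro exI conjI ballI)
    fix z assume z: "z \<in> W"
    have "((\<lambda>z. g z - T (G z)) has_derivative (\<lambda>h. g' z h - T (G' z h))) (at z)"
      by (rule has_derivative_diff[OF g(1)[rule_format, OF z]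
          bounded_linear.has_derivative[OF blinfun.bounded_linear_right G(1)[rule_format, OF z]]])
    then show "((\<lambda>z. g z - T (G z)) has_derivative blinfun_apply (g' z - (T o\<^sub>L G' z))) (at z)"
      by (simp add: blinfun.diff_left[abs_def])
    have "((\<lambda>z. g' z - (T o\<^sub>L G' z)) has_derivative (\<lambda>h. g'' z h - (T o\<^sub>L G'' z h))) (at z)"
      by (rule has_derivative_diff[OF g(2)[rule_format, OF z]
          bounded_linear.has_derivative[OF blC G(2)[rule_format, OF z]]])
    then show "((\<lambda>z. g' z - (T o\<^sub>L G' z)) has_derivative blinfun_apply (g'' z - (C o\<^sub>L G'' z))) (at z)"
      by (simp add: blinfun.diff_left[abs_def] C)
  next
    show "continuous_on W (\<lambda>z. g'' z - (C o\<^sub>L G'' z))"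
      using g(3) G(3)
      by (intro continuous_on_diff bounded_bilinear.continuous_on[OF bounded_bilinear_blinfun_compose] continuous_on_const)
  qed
qed

text \<open>
  At a stationary point the value grows like half the second derivative.  The sequences \<open>xs\<close> need not
  run along lines: because the first-order term is absent, deviations of order \<open>o(t n)\<close> from the ray
  in direction \<open>V\<close> change the value by \<open>o((t n)\<^sup>2)\<close> only.
\<close>

lemma second_order_expansion:
  fixes h :: "'a::euclidean_space \<Rightarrow> real"
  assumes "C2_on W h" "open W" "x \<in> W" and h0: "(h has_derivative (\<lambda>_. 0)) (at x)"
  obtains p :: "'a \<Rightarrow> 'a \<Rightarrow> real" where "bounded_bilinear p"
    "\<And>t xs V. (\<And>n. t n > 0) \<Longrightarrow> t \<longlonglongrightarrow> 0 \<Longrightarrow> (\<lambda>n. (xs n - x) /\<^sub>R t n) \<longlonglongrightarrow> V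
       \<Longrightarrow> (\<lambda>n. (h (xs n) - h x) / (t n)\<^sup>2) \<longlonglongrightarrow> p V V"
proof -
  obtain h' :: "'a \<Rightarrow> 'a \<Rightarrow>\<^sub>L real" and h'' where
    h': "\<And>z. z \<in> W \<Longrightarrow> (h has_derivative blinfun_apply (h' z)) (at z)" and
    h'': "\<And>z. z \<in> W \<Longrightarrow> (h' has_derivative blinfun_apply (h'' z)) (at z)"
    using assms(1) unfolding C2_on_def by metis
  have h'x: "h' x = 0"
    using has_derivative_unique[OF h'[OF assms(3)] h0] by (intro blinfun_eqI) simp
  define p where "p u v = (1/2) * h'' x u v" for u v
  have bp: "bounded_bilinear p"
  proof -
    have "bilinear p"
      unfolding bilinear_def p_def
      by (auto intro!: linearI simp: blinfun.add_right blinfun.scaleR_right blinfun.add_left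
          blinfun.scaleR_left algebra_simps)
    then show ?thesis by (simp add: bilinear_conv_bounded_bilinear)
  qed
  interpret p: bounded_bilinear p by (rule bp)
  have taylor: "\<exists>\<delta>>0. \<forall>u. norm u < \<delta> \<longrightarrow> \<bar>h (x + u) - h x - p u u\<bar> \<le> e * (norm u)\<^sup>2" if e: "e > 0" for e
  proof -
    obtain d1 where d1: "d1 > 0" "\<And>y. norm (y - x) < d1 \<Longrightarrow> norm (h' y - h' x - h'' x (y - x)) \<le> e * norm (y - x)"
      using h''[OF assms(3)] e unfolding has_derivative_at_alt by blast
    obtain d2 where d2: "d2 > 0" "ball x d2 \<subseteq> W" using assms(2,3) open_contains_ball by blast
    have "\<bar>h (x + u) - h x - p u u\<bar> \<le> e * (norm u)\<^sup>2" if u: "norm u < min d1 d2" for u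
    proof -
      \<comment> \<open>The mean value theorem for \<open>\<phi>\<close> reduces the second-order remainder to the linearisation
          error of \<open>h'\<close> at \<open>x\<close>.\<close>
      define \<phi> where "\<phi> s = h (x + s *\<^sub>R u) - s\<^sup>2 * p u u" for s :: real
      have su: "norm (s *\<^sub>R u) < min d1 d2 \<and> norm (s *\<^sub>R u) \<le> norm u" if "0 \<le> s" "s \<le> 1" for s
      proof -
        have "\<bar>s\<bar> * norm u \<le> 1 * norm u" using that by (intro mult_right_mono) auto
        then show ?thesis using u by simp
      qed
      have der: "(\<phi> has_real_derivative (h' (x + s *\<^sub>R u) u - 2 * s * p u u)) (at s)"
        if "0 \<le> s" "s \<le> 1" for s
      proof -
        have "x + s *\<^sub>R u \<in> W" using su[OF that] d2(2) by (auto simp: dist_norm)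
        note hs = h'[OF this]
        have "((\<lambda>s. h (x + s *\<^sub>R u)) has_derivative (\<lambda>k. h' (x + s *\<^sub>R u) (k *\<^sub>R u))) (at s)"
          by (rule has_derivative_compose[where f="\<lambda>s. x + s *\<^sub>R u" and g=h, OF _ hs])
            (auto intro!: derivative_eq_intros)
        moreover have "(\<lambda>k. h' (x + s *\<^sub>R u) (k *\<^sub>R u)) = (*) (h' (x + s *\<^sub>R u) u)"
          by (simp add: fun_eq_iff blinfun.scaleR_right)
        ultimately have "((\<lambda>s. h (x + s *\<^sub>R u)) has_real_derivative h' (x + s *\<^sub>R u) u) (at s)"
          by (simp only: has_field_derivative_def)
        then show ?thesis unfolding \<phi>_def by (auto intro!: derivative_eq_intros)
      qed
      obtain s where s: "0 < s" "s < 1" "\<phi> 1 - \<phi> 0 = (1 - 0) * (h' (x + s *\<^sub>R u) u - 2 * s * p u u)"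
        using MVT2[of 0 1 \<phi> "\<lambda>s. h' (x + s *\<^sub>R u) u - 2 * s * p u u"] der by auto
      have "\<phi> 1 - \<phi> 0 = (h' (x + s *\<^sub>R u) - h' x - h'' x (s *\<^sub>R u)) u"
        using s(3) by (simp add: h'x p_def blinfun.diff_left blinfun.scaleR_left blinfun.scaleR_right)
      then have "\<bar>\<phi> 1 - \<phi> 0\<bar> \<le> norm (h' (x + s *\<^sub>R u) - h' x - h'' x (s *\<^sub>R u)) * norm u"
        by (metis norm_blinfun real_norm_def)
      also have "\<dots> \<le> (e * norm u) * norm u"
      proof (rule mult_right_mono)
        have "norm (h' (x + s *\<^sub>R u) - h' x - h'' x (s *\<^sub>R u)) \<le> e * norm (s *\<^sub>R u)"
          using d1(2)[of "x + s *\<^sub>R u"] su[of s] s by simp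
        also have "\<dots> \<le> e * norm u" using su[of s] s e by (intro mult_left_mono) auto
        finally show "norm (h' (x + s *\<^sub>R u) - h' x - h'' x (s *\<^sub>R u)) \<le> e * norm u" .
      qed simp
      finally show ?thesis by (simp add: \<phi>_def power2_eq_square algebra_simps)
    qed
    then show ?thesis using d1(1) d2(1) by (intro exI[of _ "min d1 d2"]) simp
  qed
  have "(\<lambda>n. (h (xs n) - h x) / (t n)\<^sup>2) \<longlonglongrightarrow> p V V"
    if t: "\<And>n. t n > 0" "t \<longlonglongrightarrow> 0" "(\<lambda>n. (xs n - x) /\<^sub>R t n) \<longlonglongrightarrow> V" for t xs V
  proof -
    let ?u = "\<lambda>n. (xs n - x) /\<^sub>R t n"
    have "(\<lambda>n. p (?u n) (?u n)) \<longlonglongrightarrow> p V V" by (intro p.tendsto t)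
    moreover have "(\<lambda>n. (h (xs n) - h x) / (t n)\<^sup>2 - p (?u n) (?u n)) \<longlonglongrightarrow> 0"
    proof (rule LIMSEQ_I)
      fix e :: real assume e: "e > 0"
      define N where "N = norm V + 1"
      have N: "N > 0" by (simp add: N_def add_nonneg_pos)
      have "e / (2 * N\<^sup>2) > 0" using e N by simp
      from taylor[OF this] obtain \<delta> where \<delta>: "\<delta> > 0"
        "\<And>u. norm u < \<delta> \<Longrightarrow> \<bar>h (x + u) - h x - p u u\<bar> \<le> e / (2 * N\<^sup>2) * (norm u)\<^sup>2"
        by blast
      have xs: "xs \<longlonglongrightarrow> x" by (rule tendsto_of_difference_quotients[OF t])
      have "\<forall>\<^sub>F n in sequentially. dist (xs n) x < \<delta>" by (rule tendstoD[OF xs \<delta>(1)])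
      moreover have "\<forall>\<^sub>F n in sequentially. norm (?u n) < N"
        using order_tendstoD(2)[OF tendsto_norm[OF t(3)], of N] by (simp add: N_def)
      ultimately have "\<forall>\<^sub>F n in sequentially. norm ((h (xs n) - h x) / (t n)\<^sup>2 - p (?u n) (?u n) - 0) < e"
      proof eventually_elim
        case (elim n)
        have tn: "t n > 0" by (rule t)
        have "\<bar>h (xs n) - h x - p (xs n - x) (xs n - x)\<bar> \<le> e / (2 * N\<^sup>2) * (norm (xs n - x))\<^sup>2"
          using \<delta>(2)[of "xs n - x"] elim(1) by (simp add: dist_norm)
        then have "\<bar>h (xs n) - h x - p (xs n - x) (xs n - x)\<bar> / (t n)\<^sup>2 \<le> e / (2 * N\<^sup>2) * (norm (xs n - x))\<^sup>2 / (t n)\<^sup>2"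
          by (intro divide_right_mono) auto
        also have "\<dots> = e / (2 * N\<^sup>2) * (norm (xs n - x) / t n)\<^sup>2"
          by (simp only: power_divide times_divide_eq_right)
        also have "norm (xs n - x) / t n = norm (?u n)"
          using tn by (simp add: divide_inverse_commute)
        also have "e / (2 * N\<^sup>2) * (norm (?u n))\<^sup>2 \<le> e / (2 * N\<^sup>2) * N\<^sup>2"
        proof (rule mult_left_mono)
          show "(norm (?u n))\<^sup>2 \<le> N\<^sup>2" using elim(2) by (intro power_mono less_imp_le norm_ge_zero)
          show "0 \<le> e / (2 * N\<^sup>2)" using e by simp
        qed
        also have "\<dots> < e" using N e by simp
        finally have "\<bar>h (xs n) - h x - p (xs n - x) (xs n - x)\<bar> / (t n)\<^sup>2 < e" .
        moreover have "p (?u n) (?u n) = p (xs n - x) (xs n - x) / (t n)\<^sup>2"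
          unfolding p.scaleR_left p.scaleR_right real_scaleR_def
          by (simp only: power2_eq_square divide_inverse inverse_mult_distrib mult_ac)
        then have "(h (xs n) - h x) / (t n)\<^sup>2 - p (?u n) (?u n) - 0 = (h (xs n) - h x - p (xs n - x) (xs n - x)) / (t n)\<^sup>2"
          by (simp only: diff_divide_distrib diff_zero)
        ultimately show ?case by (simp only: real_norm_def abs_divide abs_power2)
      qed
      then show "\<exists>no. \<forall>n\<ge>no. norm ((h (xs n) - h x) / (t n)\<^sup>2 - p (?u n) (?u n) - 0) < e"
        by (simp add: eventually_sequentially)
    qed
    ultimately show ?thesis by (rule Lim_transform)
  qed
  then show ?thesis using that bp by blast
qed

text \<open>
  The sequences admitted here approach \<open>x\<close> in the direction \<open>V\<close> and carry subgradients that tend to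
  \<open>0\<close>, which is exactly what forces their points into a set identifiable at \<open>x\<close> for \<open>0\<close>.  The content
  is that one bilinear \<open>p\<close> serves all directions and all such sequences.
\<close>

definition second_order_form :: "('a::euclidean_space \<Rightarrow> real) \<Rightarrow> 'a \<Rightarrow> ('a \<Rightarrow> 'a \<Rightarrow> real) \<Rightarrow> bool" where
  "second_order_form f x p \<longleftrightarrow> bounded_bilinear p \<and>
     (\<forall>t xs vs V. (\<forall>n. t n > 0) \<longrightarrow> t \<longlonglongrightarrow> 0 \<longrightarrow> (\<lambda>n. (xs n - x) /\<^sub>R t n) \<longlonglongrightarrow> V \<longrightarrow>
        vs \<longlonglongrightarrow> 0 \<longrightarrow> (\<forall>n. vs n \<in> limiting_subdifferential f (xs n)) \<longrightarrow>
        (\<lambda>n. (f (xs n) - f x) / (t n)\<^sup>2) \<longlonglongrightarrow> p V V)"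

lemma second_order_form_bilinear: "second_order_form f x p \<Longrightarrow> bounded_bilinear p"
  by (simp add: second_order_form_def)

lemma second_order_formD:
  assumes "second_order_form f x p" "\<And>n. t n > 0" "t \<longlonglongrightarrow> 0" "(\<lambda>n. (xs n - x) /\<^sub>R t n) \<longlonglongrightarrow> V"
    "vs \<longlonglongrightarrow> 0" "\<And>n. vs n \<in> limiting_subdifferential f (xs n)"
  shows "(\<lambda>n. (f (xs n) - f x) / (t n)\<^sup>2) \<longlonglongrightarrow> p V V"
  using assms unfolding second_order_form_def by blast

text \<open>
  Near-critical sequences end up in the manifold \<open>M\<close>, where \<open>f\<close> agrees with a smooth \<open>g\<close>, so the
  second derivative of a suitable Lagrangian of \<open>g\<close> describes them all.  The multiplier exists because
  the derivative of \<open>g\<close> vanishes on the tangent space: along points of \<open>M\<close> leaving \<open>x\<close> in a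
  tangent direction \<open>d\<close>, and likewise in the direction \<open>- d\<close>, the quadratic lower bound on \<open>f\<close>
  rules out a linear decrease.
\<close>

lemma identifiable_manifold_second_order_form:
  fixes f :: "'a::euclidean_space \<Rightarrow> real"
  assumes M: "C2_identifiable_manifold f M x 0"
    and lower: "\<forall>\<^sub>F z in nhds x. f z \<ge> f x - K * (norm (z - x))\<^sup>2"
  obtains p where "second_order_form f x p"
proof -
  have ident: "identifiable f M x 0" using M by (simp add: C2_identifiable_manifold_def)
  then have xM: "x \<in> M" by (simp add: identifiable_def)
  obtain W0 where W0: "open W0" "x \<in> W0" "C2_submanifold (M \<inter> W0)" "C2_restriction f (M \<inter> W0)"
    using M unfolding C2_identifiable_manifold_def by blast
  have x0: "x \<in> M \<inter> W0" using xM W0 by blast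
  obtain W1 S and G :: "'a \<Rightarrow> 'a" where G: "open W1" "x \<in> W1" "subspace S" "C2_on W1 G" "G ` W1 \<subseteq> S"
    "\<forall>z\<in>W1. range (frechet_derivative G (at z)) = S" "M \<inter> W0 \<inter> W1 = {z \<in> W1. G z = 0}"
    using W0(3) x0 unfolding C2_submanifold_def by meson
  obtain W2 g where g: "open W2" "x \<in> W2" "C2_on W2 g" "\<forall>z\<in>M \<inter> W0 \<inter> W2. g z = f z"
    using W0(4) x0 unfolding C2_restriction_def by meson
  define W where "W = W0 \<inter> W1 \<inter> W2"
  have W: "open W" "x \<in> W" using W0 G g by (auto simp: W_def)
  then obtain r where r: "r > 0" "ball x r \<subseteq> W" using open_contains_ball by blast
  have onM: "f z = g z" if "z \<in> W" "G z = 0" for z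
  proof -
    have "z \<in> M \<inter> W0 \<inter> W1" using G(7) that by (auto simp: W_def)
    then show ?thesis using g(4) that by (auto simp: W_def)
  qed
  have Mzero: "G z = 0" if "z \<in> W" "z \<in> M" for z using G(7) that by (auto simp: W_def)
  have Gx: "G x = 0" using Mzero W xM by blast
  define D where "D = frechet_derivative G (at x)"
  define Dg where "Dg = frechet_derivative g (at x)"
  have sG: "strict_derivative G D x" unfolding D_def by (rule C2_on_strict_derivative[OF G(4,1,2)])
  have sg: "strict_derivative g Dg x" unfolding Dg_def by (rule C2_on_strict_derivative[OF g(3,1,2)])
  have lD: "linear D" "linear Dg" using sG sg by (simp_all add: strict_derivative_def)
  have rD: "range D = S" using G by (auto simp: D_def)
  have GS: "G z \<in> S" if "z \<in> ball x r" for z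
  proof -
    have "z \<in> W1" using that r(2) unfolding W_def by blast
    then show ?thesis using G(5) by blast
  qed
  have nonneg: "Dg d \<ge> 0" if d: "D d = 0" for d
  proof -
    obtain t zs where tz: "\<And>n. t n > (0::real)" "t \<longlonglongrightarrow> 0" "\<And>n. zs n \<in> ball x r" "\<And>n. G (zs n) = 0"
      "(\<lambda>n. (zs n - x) /\<^sub>R t n) \<longlonglongrightarrow> d"
      using tangent_sequence[OF sG G(3) _ Gx r(1) GS d] rD by blast
    have "(\<lambda>n. (g (zs n) - g x) /\<^sub>R t n) \<longlonglongrightarrow> Dg d"
      by (rule directional_difference_quotients[OF sg tz(1,2,5)])
    moreover have "(\<lambda>n. - K * t n * (norm ((zs n - x) /\<^sub>R t n))\<^sup>2) \<longlonglongrightarrow> - K * 0 * (norm d)\<^sup>2"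
      by (intro tendsto_intros tz(2) tz(5))
    moreover have "\<forall>\<^sub>F n in sequentially. - K * t n * (norm ((zs n - x) /\<^sub>R t n))\<^sup>2 \<le> (g (zs n) - g x) /\<^sub>R t n"
    proof -
      have "zs \<longlonglongrightarrow> x" by (rule tendsto_of_difference_quotients[OF tz(1,2,5)])
      then have "\<forall>\<^sub>F n in sequentially. f (zs n) \<ge> f x - K * (norm (zs n - x))\<^sup>2"
        using lower by (rule eventually_compose_filterlim[rotated])
      then show ?thesis
      proof eventually_elim
        case (elim n)
        have "f (zs n) = g (zs n)" "f x = g x" using onM tz(3,4) r W Gx by blast+
        then have "- K * (norm (zs n - x))\<^sup>2 / t n \<le> (g (zs n) - g x) / t n"
          using elim tz(1)[of n] by (intro divide_right_mono) auto
        moreover have "norm ((zs n - x) /\<^sub>R t n) = norm (zs n - x) / t n"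
          using tz(1)[of n] by (simp add: divide_inverse mult.commute)
        then have "- K * t n * (norm ((zs n - x) /\<^sub>R t n))\<^sup>2 = - K * (norm (zs n - x))\<^sup>2 / t n"
          using tz(1)[of n] by (simp add: power_divide power2_eq_square)
        moreover have "(g (zs n) - g x) /\<^sub>R t n = (g (zs n) - g x) / t n"
          by (simp add: divide_inverse_commute)
        ultimately show ?case by (simp only:)
      qed
    qed
    ultimately have "- K * 0 * (norm d)\<^sup>2 \<le> Dg d"
      by (intro tendsto_le[OF sequentially_bot])
    then show ?thesis by simp
  qed
  have tangent_zero: "Dg d = 0" if "D d = 0" for d
    using nonneg[of d] nonneg[of "- d"] that by (simp add: linear_neg[OF lD(1)] linear_neg[OF lD(2)])
  obtain R where R: "linear R" "\<And>s. s \<in> S \<Longrightarrow> D (R s) = s"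
    using linear_exists_right_inverse_on[OF lD(1) subspace_UNIV] rD by blast
  \<comment> \<open>\<open>Dg\<close> vanishes on the kernel of \<open>D\<close>, hence factors as \<open>T \<circ> D\<close>: this is the Lagrange multiplier.\<close>
  define T where "T = Blinfun (Dg \<circ> R)"
  have "bounded_linear (Dg \<circ> R)"
    using linear_compose[OF R(1) lD(2)] by (simp add: linear_conv_bounded_linear)
  then have T: "T s = Dg (R s)" for s unfolding T_def by (simp add: bounded_linear_Blinfun_apply)
  define h where "h z = g z - T (G z)" for z
  have C2h: "C2_on W h"
    unfolding h_def
    by (intro C2_on_diff_linear C2_on_subset[OF G(4)] C2_on_subset[OF g(3)]) (auto simp: W_def)
  have "(h has_derivative (\<lambda>v. Dg v - T (D v))) (at x)"
    unfolding h_def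
    by (rule has_derivative_diff[OF strict_derivative_imp_has_derivative[OF sg]
        bounded_linear.has_derivative[OF blinfun.bounded_linear_right
          strict_derivative_imp_has_derivative[OF sG]]])
  moreover have "Dg v - T (D v) = 0" for v
  proof -
    have "D (v - R (D v)) = 0" using R(2)[of "D v"] rD by (auto simp: linear_diff[OF lD(1)])
    from tangent_zero[OF this] show ?thesis by (simp add: T linear_diff[OF lD(2)])
  qed
  ultimately have h0: "(h has_derivative (\<lambda>_. 0)) (at x)" by simp
  obtain p where p: "bounded_bilinear p"
    "\<And>t xs V. (\<And>n. t n > 0) \<Longrightarrow> t \<longlonglongrightarrow> 0 \<Longrightarrow> (\<lambda>n. (xs n - x) /\<^sub>R t n) \<longlonglongrightarrow> V
       \<Longrightarrow> (\<lambda>n. (h (xs n) - h x) / (t n)\<^sup>2) \<longlonglongrightarrow> p V V"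
    using second_order_expansion[OF C2h W h0] by blast
  have "(\<lambda>n. (f (xs n) - f x) / (t n)\<^sup>2) \<longlonglongrightarrow> p V V"
    if t: "\<And>n. t n > 0" "t \<longlonglongrightarrow> 0" "(\<lambda>n. (xs n - x) /\<^sub>R t n) \<longlonglongrightarrow> V"
      and vs: "vs \<longlonglongrightarrow> 0" "\<And>n. vs n \<in> limiting_subdifferential f (xs n)" for t xs vs V
  proof -
    have xs: "xs \<longlonglongrightarrow> x" by (rule tendsto_of_difference_quotients[OF t])
    have "\<forall>\<^sub>F n in sequentially. xs n \<in> M" using ident xs vs unfolding identifiable_def by blast
    moreover have "\<forall>\<^sub>F n in sequentially. xs n \<in> W" by (rule topological_tendstoD[OF xs W])
    ultimately have "\<forall>\<^sub>F n in sequentially. (h (xs n) - h x) / (t n)\<^sup>2 = (f (xs n) - f x) / (t n)\<^sup>2"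
    proof eventually_elim
      case (elim n)
      have "G (xs n) = 0" using Mzero elim by blast
      then show ?case using onM[of "xs n"] onM[of x] Gx W elim by (simp add: h_def)
    qed
    then show ?thesis using p(2)[OF t] by (rule Lim_transform_eventually[rotated])
  qed
  then have "second_order_form f x p" using p(1) unfolding second_order_form_def by blast
  then show ?thesis by (rule that)
qed

section \<open>Vertices and normal cones of slices of a cube\<close>

lemma orth_proj_subspace:
  assumes S: "subspace S"
  shows "orth_proj S x \<in> S" "s \<in> S \<Longrightarrow> x \<bullet> s = orth_proj S x \<bullet> s"
proof -
  obtain p z where pz: "p \<in> span S" "\<And>w. w \<in> span S \<Longrightarrow> orthogonal z w" "x = p + z"
    using orthogonal_subspace_decomp_exists[of S x] by metis
  have sp: "span S = S" using S by (simp add: span_eq_iff)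
  have p: "p \<in> S \<and> (\<forall>s\<in>S. (x - p) \<bullet> s = 0)"
    using pz unfolding sp by (simp add: orthogonal_def)
  have "orth_proj S x = p"
    unfolding orth_proj_def
  proof (rule the_equality)
    show "p \<in> S \<and> (\<forall>s\<in>S. (x - p) \<bullet> s = 0)" by (rule p)
  next
    fix p' assume p': "p' \<in> S \<and> (\<forall>s\<in>S. (x - p') \<bullet> s = 0)"
    have "p - p' \<in> S" using p p' S by (simp add: subspace_diff)
    then have "(x - p') \<bullet> (p - p') = 0" "(x - p) \<bullet> (p - p') = 0" using p p' by blast+
    then have "(p - p') \<bullet> (p - p') = 0" by (simp add: inner_diff_left)
    then show "p' = p" by simp
  qed
  with p show "orth_proj S x \<in> S" "s \<in> S \<Longrightarrow> x \<bullet> s = orth_proj S x \<bullet> s"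
    by (simp_all add: inner_diff_left)
qed

text \<open>
  From a relative interior point one can step beyond it, away from \<open>w\<close>, and stay in \<open>N\<close>.  If the
  functional vanished at the relative interior point it would become positive there.
\<close>

lemma rel_interior_functional_neg:
  fixes N :: "'a::euclidean_space set"
  assumes "convex N" "\<And>w. w \<in> N \<Longrightarrow> w \<bullet> d \<le> 0" and w: "w \<in> N" "w \<bullet> d < 0"
    and w0: "w0 \<in> rel_interior N"
  shows "w0 \<bullet> d < 0"
proof -
  have "w \<in> affine hull N" using w(1) by (simp add: hull_inc)
  then obtain e where e: "e > 1" "(1 - e) *\<^sub>R w + e *\<^sub>R w0 \<in> N"
    using convex_rel_interior_if2[OF assms(1) w0] by blast
  have "(1 - e) * (w \<bullet> d) + e * (w0 \<bullet> d) \<le> 0"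
    using assms(2)[OF e(2)] by (simp add: inner_add_left)
  moreover have "(1 - e) * (w \<bullet> d) > 0" using e(1) w(2) by (simp add: mult_neg_neg)
  ultimately have "e * (w0 \<bullet> d) < 0" by linarith
  then show ?thesis using e(1) by (simp add: mult_less_0_iff)
qed

lemma linear_same_dim_kernel_trivial:
  fixes g :: "'a::euclidean_space \<Rightarrow> 'b::euclidean_space"
  assumes g: "linear g" and R: "subspace R" "dim (g ` R) = dim R" and x: "x \<in> R" "g x = 0"
  shows "x = 0"
proof -
  obtain h where h: "h ` UNIV \<subseteq> R" "linear h" "\<forall>v\<in>g ` R. g (h v) = v"
    using linear_exists_right_inverse_on[OF g R(1)] by blast
  have sub: "subspace (g ` R)" by (rule linear_subspace_image[OF g R(1)])
  have "inj_on h (g ` R)" using h(3) by (metis inj_onI)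
  then have "inj_on h (span (g ` R))" using sub by (simp add: span_eq_iff[THEN iffD2])
  then have "dim (h ` g ` R) = dim (g ` R)" by (rule dim_image_eq[OF h(2)])
  then have "h ` g ` R = R"
    using h(1) R by (intro subspace_dim_equal linear_subspace_image[OF h(2) sub]) auto
  then obtain y where y: "y \<in> g ` R" "x = h y" using x(1) by blast
  then have "y = 0" using h(3) x(2) by auto
  then show ?thesis using y linear_0[OF h(2)] by simp
qed

lemma subspace_coord_space: "subspace (coord_space I)"
  by (auto simp: subspace_def coord_space_def)

lemma linear_restr: "linear (restr I)"
  by (auto intro!: linearI simp: restr_def vec_eq_iff)

lemma proper_subspace_orthogonal:
  fixes S T :: "'a::euclidean_space set"
  assumes "subspace S" "subspace T" "S \<subseteq> T" "S \<noteq> T"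
  obtains x where "x \<noteq> 0" "x \<in> T" "\<And>y. y \<in> S \<Longrightarrow> x \<bullet> y = 0"
proof -
  have "span S \<subset> span T" using assms by (simp add: span_eq_iff[THEN iffD2] psubset_eq)
  then obtain x where "x \<noteq> 0" "x \<in> span T" "\<And>y. y \<in> span S \<Longrightarrow> orthogonal x y"
    using orthogonal_to_subspace_exists_gen by metis
  then show ?thesis using that assms by (simp add: span_eq_iff[THEN iffD2] orthogonal_def)
qed

text \<open>
  The clean multiplier polytope in isolation: the part of the cube \<open>[-1, 1]\<^sup>\<Omega>\<close> in which a linear
  system \<open>adjoint J v = b\<close> holds.
\<close>

locale box_slice =
  fixes J :: "'a::euclidean_space \<Rightarrow> real^'m::finite" and \<Omega> :: "'m set" and b :: 'a
  assumes linear_J: "linear J" and range_J: "J V \<in> coord_space \<Omega>"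
begin

definition direction :: "(real^'m) set" where
  "direction = {v \<in> coord_space \<Omega>. adjoint J v = 0}"

definition polytope :: "(real^'m) set" where
  "polytope = {v \<in> coord_space \<Omega>. (\<forall>i\<in>\<Omega>. -1 \<le> v $ i \<and> v $ i \<le> 1) \<and> adjoint J v = b}"

definition ncone :: "real^'m \<Rightarrow> (real^'m) set" where
  "ncone \<nu> = {w \<in> direction. \<forall>v\<in>polytope. w \<bullet> (v - \<nu>) \<le> 0}"

lemma direction_iff: "v \<in> direction \<longleftrightarrow> v \<in> coord_space \<Omega> \<and> (\<forall>V. J V \<bullet> v = 0)"
proof -
  have "adjoint J v = 0 \<longleftrightarrow> (\<forall>V. J V \<bullet> v = 0)"
    by (metis adjoint_works[OF linear_J] inner_eq_zero_iff inner_zero_right)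
  then show ?thesis by (simp add: direction_def)
qed

lemma subspace_direction: "subspace direction"
proof -
  have "direction = coord_space \<Omega> \<inter> {v. adjoint J v = 0}" by (auto simp: direction_def)
  then show ?thesis
    using subspace_coord_space[of \<Omega>] linear_subspace_kernel[OF adjoint_linear[OF linear_J]]
    by (simp add: subspace_inter)
qed

lemma convex_ncone: "convex (ncone \<nu>)"
proof -
  have "ncone \<nu> = direction \<inter> (\<Inter>v\<in>polytope. {w. (v - \<nu>) \<bullet> w \<le> 0})"
    by (auto simp: ncone_def inner_commute)
  then show ?thesis
    using subspace_imp_convex[OF subspace_direction]
    by (auto intro!: convex_Int convex_INT convex_halfspace_le)
qed

lemma polytope_diff: "v \<in> polytope \<Longrightarrow> \<nu> \<in> polytope \<Longrightarrow> v - \<nu> \<in> direction"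
  using subspace_diff[OF subspace_coord_space]
  by (auto simp: polytope_def direction_def linear_diff[OF adjoint_linear[OF linear_J]])

text \<open>
  Of the finitely many inequalities, those tight at \<open>\<nu>\<close> survive a small step by the sign condition, and
  the others by their slack.
\<close>

lemma polytope_move:
  assumes \<nu>: "\<nu> \<in> polytope" and d: "d \<in> direction"
    and inward: "\<And>i. i \<in> \<Omega> \<Longrightarrow> \<bar>\<nu> $ i\<bar> = 1 \<Longrightarrow> \<nu> $ i * d $ i \<le> 0"
  obtains t where "t > 0" "\<nu> + t *\<^sub>R d \<in> polytope"
proof -
  have "\<forall>i. \<exists>t>0. i \<in> \<Omega> \<longrightarrow> (\<forall>s. 0 < s \<longrightarrow> s \<le> t \<longrightarrow> \<bar>(\<nu> + s *\<^sub>R d) $ i\<bar> \<le> 1)"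
  proof
    fix i
    show "\<exists>t>0. i \<in> \<Omega> \<longrightarrow> (\<forall>s. 0 < s \<longrightarrow> s \<le> t \<longrightarrow> \<bar>(\<nu> + s *\<^sub>R d) $ i\<bar> \<le> 1)"
    proof (cases "i \<in> \<Omega>")
      case True
      have le: "\<bar>\<nu> $ i\<bar> \<le> 1" using \<nu> True by (auto simp: polytope_def abs_le_iff)
      define t where "t = (if \<bar>\<nu> $ i\<bar> = 1 then 1 else 1 - \<bar>\<nu> $ i\<bar>) / (\<bar>d $ i\<bar> + 1)"
      have t: "t > 0" using le by (auto simp: t_def intro!: divide_pos_pos)
      have "\<bar>\<nu> $ i + s * d $ i\<bar> \<le> 1" if s: "0 < s" "s \<le> t" for s
      proof -
        have sd: "\<bar>s * d $ i\<bar> \<le> (if \<bar>\<nu> $ i\<bar> = 1 then 1 else 1 - \<bar>\<nu> $ i\<bar>)"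
        proof -
          have "\<bar>s * d $ i\<bar> \<le> t * (\<bar>d $ i\<bar> + 1)"
            using s by (simp add: abs_mult mult_mono)
          also have "\<dots> = (if \<bar>\<nu> $ i\<bar> = 1 then 1 else 1 - \<bar>\<nu> $ i\<bar>)"
            unfolding t_def by (simp add: add_nonneg_eq_0_iff)
          finally show ?thesis .
        qed
        show ?thesis
        proof (cases "\<bar>\<nu> $ i\<bar> = 1")
          case True': True
          have "s * (\<nu> $ i * d $ i) \<le> 0"
            using s inward[OF True True'] by (simp add: mult_nonneg_nonpos)
          moreover have "\<nu> $ i = 1 \<or> \<nu> $ i = -1" using True' by linarith
          ultimately show ?thesis using sd True' by auto
        next
          case False
          then show ?thesis using sd abs_triangle_ineq[of "\<nu> $ i" "s * d $ i"] by simp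
        qed
      qed
      then show ?thesis using t by (intro exI[of _ t]) simp
    qed (use zero_less_one in blast)
  qed
  then obtain t where t: "\<And>i. t i > 0"
    "\<And>i s. i \<in> \<Omega> \<Longrightarrow> 0 < s \<Longrightarrow> s \<le> t i \<Longrightarrow> \<bar>(\<nu> + s *\<^sub>R d) $ i\<bar> \<le> 1"
    by metis
  define s where "s = Min (range t)"
  have s: "s > 0" "\<And>i. s \<le> t i" using t(1) by (auto simp: s_def)
  have "\<bar>(\<nu> + s *\<^sub>R d) $ i\<bar> \<le> 1" if "i \<in> \<Omega>" for i using t(2)[OF that s(1) s(2)] .
  moreover have "adjoint J (\<nu> + s *\<^sub>R d) = b"
    using \<nu> d by (simp add: polytope_def direction_def linear_add[OF adjoint_linear[OF linear_J]]
        linear_cmul[OF adjoint_linear[OF linear_J]])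
  moreover have "\<nu> + s *\<^sub>R d \<in> coord_space \<Omega>"
    using \<nu> d subspace_coord_space[of \<Omega>]
    by (auto simp: polytope_def direction_def intro!: subspace_add subspace_scale)
  ultimately have "\<nu> + s *\<^sub>R d \<in> polytope"
    by (auto simp only: polytope_def abs_le_iff minus_le_iff mem_Collect_eq)
  then show ?thesis using that s(1) by blast
qed

text \<open>
  A direction that leaves all tight coordinates fixed can be followed both ways inside the polytope,
  which would place \<open>\<nu>\<close> in the interior of a segment.
\<close>

lemma vertex_no_free_direction:
  assumes vert: "\<nu> extreme_point_of polytope" and d: "d \<in> direction"
    and free: "\<And>i. i \<in> \<Omega> \<Longrightarrow> \<bar>\<nu> $ i\<bar> = 1 \<Longrightarrow> d $ i = 0"
  shows "d = 0"
proof (rule ccontr)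
  assume nz: "d \<noteq> 0"
  have \<nu>: "\<nu> \<in> polytope" using vert by (simp add: extreme_point_of_def)
  obtain s where s: "s > 0" "\<nu> + s *\<^sub>R d \<in> polytope"
    using polytope_move[OF \<nu> d] free by auto
  have "- d \<in> direction" using subspace_neg[OF subspace_direction d] .
  then obtain t where t: "t > 0" "\<nu> + t *\<^sub>R - d \<in> polytope"
    using polytope_move[OF \<nu>, of "- d"] free by auto
  have "\<nu> \<in> open_segment (\<nu> + s *\<^sub>R d) (\<nu> + t *\<^sub>R - d)"
    unfolding in_segment
  proof (intro conjI exI[of _ "s / (s + t)"])
    have "s *\<^sub>R d \<noteq> t *\<^sub>R - d"
    proof
      assume "s *\<^sub>R d = t *\<^sub>R - d"
      then have "(s + t) *\<^sub>R d = 0" by (simp add: scaleR_add_left)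
      then show False using nz s t by simp
    qed
    then show "\<nu> + s *\<^sub>R d \<noteq> \<nu> + t *\<^sub>R - d" by simp
    show "0 < s / (s + t)" "s / (s + t) < 1" using s t by (simp_all add: field_simps)
    have "(1 - s / (s + t)) * s - s / (s + t) * t = 0" using s t by (simp add: field_simps)
    moreover have "(1 - s / (s + t)) *\<^sub>R (\<nu> + s *\<^sub>R d) + (s / (s + t)) *\<^sub>R (\<nu> + t *\<^sub>R - d)
        = \<nu> + ((1 - s / (s + t)) * s - s / (s + t) * t) *\<^sub>R d"
      by (simp add: algebra_simps)
    ultimately show "\<nu> = (1 - s / (s + t)) *\<^sub>R (\<nu> + s *\<^sub>R d) + (s / (s + t)) *\<^sub>R (\<nu> + t *\<^sub>R - d)"
      by simp
  qed
  then show False using vert s(2) t(2) by (auto simp: extreme_point_of_def)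
qed

text \<open>
  A vector supported on the free coordinates and orthogonal to the restricted range is a direction of
  the polytope that fixes the tight coordinates, hence zero.
\<close>

lemma vertex_restr_surjective:
  assumes vert: "\<nu> extreme_point_of polytope" and I: "I = {i \<in> \<Omega>. \<bar>\<nu> $ i\<bar> < 1}"
  shows "coord_space I \<subseteq> range (\<lambda>V. restr I (J V))"
proof (rule ccontr)
  assume not: "\<not> ?thesis"
  let ?R = "range (\<lambda>V. restr I (J V))"
  have lin: "linear (\<lambda>V. restr I (J V))"
    using linear_compose[OF linear_J linear_restr] by (simp add: o_def)
  have "?R \<subseteq> coord_space I" by (auto simp: restr_def coord_space_def)
  with not obtain d where d: "d \<noteq> 0" "d \<in> coord_space I" "\<And>y. y \<in> ?R \<Longrightarrow> d \<bullet> y = 0"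
    using proper_subspace_orthogonal[OF linear_subspace_image[OF lin subspace_UNIV] subspace_coord_space[of I]]
    by blast
  have "J V \<bullet> d = 0" for V
  proof -
    have "d \<bullet> J V = d \<bullet> restr I (J V)"
      using d(2) by (auto simp: inner_vec_def restr_def coord_space_def intro!: sum.cong)
    then show ?thesis using d(3)[of "restr I (J V)"] by (simp add: inner_commute)
  qed
  moreover have "d \<in> coord_space \<Omega>" using d(2) I by (auto simp: coord_space_def)
  ultimately have "d \<in> direction" by (simp add: direction_iff)
  moreover have "d $ i = 0" if "\<bar>\<nu> $ i\<bar> = 1" for i using d(2) that I by (auto simp: coord_space_def)
  ultimately show False using vertex_no_free_direction[OF vert] d(1) by blast
qed

text \<open>
  The rank condition says that only \<open>0\<close> in \<open>range J\<close> vanishes on \<open>I\<close>.  By duality the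
  directions of the polytope attain arbitrary values on the coordinates of \<open>\<Omega>\<close> outside \<open>I\<close>, so
  constraints on these coordinates can be tested one at a time.
\<close>

lemma active_coordinates_free:
  assumes I: "I \<subseteq> \<Omega>" and rank: "dim (range (\<lambda>V. restr I (J V))) = dim (range J)"
    and a: "a \<in> coord_space (\<Omega> - I)"
  obtains d where "d \<in> direction" "\<And>i. i \<in> \<Omega> - I \<Longrightarrow> d $ i = a $ i"
proof -
  let ?S = "restr (\<Omega> - I) ` direction"
  have "coord_space (\<Omega> - I) = ?S"
  proof (rule ccontr)
    assume ne: "coord_space (\<Omega> - I) \<noteq> ?S"
    have "?S \<subseteq> coord_space (\<Omega> - I)" by (auto simp: restr_def coord_space_def)
    then obtain c where c: "c \<noteq> 0" "c \<in> coord_space (\<Omega> - I)" "\<And>y. y \<in> ?S \<Longrightarrow> c \<bullet> y = 0"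
      using proper_subspace_orthogonal[OF linear_subspace_image[OF linear_restr subspace_direction]
          subspace_coord_space[of "\<Omega> - I"]] ne by metis
    have c_perp: "c \<bullet> d = 0" if "d \<in> direction" for d
    proof -
      have "c \<bullet> d = c \<bullet> restr (\<Omega> - I) d"
        using c(2) by (auto simp: inner_vec_def restr_def coord_space_def intro!: sum.cong)
      then show ?thesis using c(3) that by simp
    qed
    have sR: "subspace (range J)" by (rule linear_subspace_image[OF linear_J subspace_UNIV])
    obtain p z where pz: "p \<in> span (range J)" "\<And>w. w \<in> span (range J) \<Longrightarrow> orthogonal z w" "c = p + z"
      using orthogonal_subspace_decomp_exists[of "range J" c] by metis
    have pR: "p \<in> range J" and zR: "\<And>w. w \<in> range J \<Longrightarrow> z \<bullet> w = 0"
      using pz sR by (simp_all add: span_eq_iff[THEN iffD2] orthogonal_def)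
    have "c \<in> coord_space \<Omega>" "p \<in> coord_space \<Omega>"
      using c(2) pR range_J by (auto simp: coord_space_def)
    then have "z \<in> coord_space \<Omega>" using pz(3) by (simp add: coord_space_def)
    then have zN: "z \<in> direction" using zR by (metis direction_iff inner_commute rangeI)
    have "z \<bullet> z = 0"
      using c_perp[OF zN] zR[OF pR] pz(3) by (simp add: inner_add_left inner_add_right inner_commute)
    then have cR: "c \<in> range J" using pz(3) pR by simp
    have "restr I c = 0" using c(2) by (auto simp: restr_def coord_space_def vec_eq_iff)
    moreover have "dim (restr I ` range J) = dim (range J)" using rank by (simp add: image_image)
    ultimately have "c = 0"
      using linear_same_dim_kernel_trivial[OF linear_restr sR _ cR] by blast
    then show False using c(1) by simp
  qed
  then obtain d where d: "d \<in> direction" "a = restr (\<Omega> - I) d" using a by blast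
  show ?thesis by (rule that[OF d(1)]) (simp add: d(2) restr_def)
qed

text \<open>
  The outward normal \<open>s\<close> that adds up the tight constraints lies, after projection, in the normal cone
  and is strictly negative on every feasible direction that moves a tight coordinate; relative interior
  points inherit this.  Projecting onto the direction space does not change inner products with \<open>d\<close>.
\<close>

lemma relint_ncone_strict:
  assumes \<nu>: "\<nu> \<in> polytope" and w: "orth_proj direction w \<in> rel_interior (ncone \<nu>)"
    and d: "d \<in> direction" and t: "t > 0" "\<nu> + t *\<^sub>R d \<in> polytope"
    and active: "i \<in> \<Omega>" "\<bar>\<nu> $ i\<bar> = 1" "d $ i \<noteq> 0"
  shows "w \<bullet> d < 0"
proof -
  define s :: "real^'m" where "s = (\<chi> i. if i \<in> \<Omega> \<and> \<bar>\<nu> $ i\<bar> = 1 then \<nu> $ i else 0)"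
  note P = orth_proj_subspace[OF subspace_direction]
  have term_le: "s $ j * (v - \<nu>) $ j \<le> 0" if v: "v \<in> polytope" for v j
  proof (cases "j \<in> \<Omega> \<and> \<bar>\<nu> $ j\<bar> = 1")
    case True
    then have "\<nu> $ j = 1 \<or> \<nu> $ j = -1" by linarith
    then show ?thesis using v True by (auto simp: s_def polytope_def)
  qed (auto simp: s_def)
  have s_le: "s \<bullet> (v - \<nu>) \<le> 0" if "v \<in> polytope" for v
    unfolding inner_vec_def using term_le[OF that] by (intro sum_nonpos) simp
  have "orth_proj direction s \<bullet> (v - \<nu>) \<le> 0" if "v \<in> polytope" for v
    using s_le[OF that] P(2)[OF polytope_diff[OF that \<nu>], of s] by simp
  then have in_cone: "orth_proj direction s \<in> ncone \<nu>" using P(1) by (simp add: ncone_def)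
  have "s \<bullet> (t *\<^sub>R d) < 0"
  proof -
    have le: "s $ j * (t * d $ j) \<le> 0" for j using term_le[OF t(2), of j] by simp
    have "s $ i * (t * d $ i) \<noteq> 0" using active t(1) by (auto simp: s_def)
    with le[of i] have "s $ i * (t * d $ i) < 0" by linarith
    then have "(\<Sum>j\<in>UNIV. s $ j * (t * d $ j)) < (\<Sum>j\<in>(UNIV :: 'm set). 0)"
      using le by (intro sum_strict_mono_ex1) auto
    then show ?thesis by (simp add: inner_vec_def)
  qed
  then have "s \<bullet> d < 0" using t(1) by (simp add: mult_less_0_iff)
  then have strict: "orth_proj direction s \<bullet> d < 0" using P(2)[OF d, of s] by simp
  have "x \<bullet> d \<le> 0" if "x \<in> ncone \<nu>" for x
  proof -
    have "x \<bullet> (\<nu> + t *\<^sub>R d - \<nu>) \<le> 0" using that t(2) unfolding ncone_def by blast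
    then show ?thesis using t(1) by (simp add: mult_le_0_iff)
  qed
  then have "orth_proj direction w \<bullet> d < 0"
    by (rule rel_interior_functional_neg[OF convex_ncone _ in_cone strict w])
  then show ?thesis using P(2)[OF d, of w] by simp
qed

text \<open>
  The segment from a vertex to any other point of the polytope moves a tight coordinate.
\<close>

lemma relint_ncone_separates:
  assumes vert: "\<nu> extreme_point_of polytope" and v: "v \<in> polytope" "v \<noteq> \<nu>"
    and w: "orth_proj direction w \<in> rel_interior (ncone \<nu>)"
  shows "w \<bullet> (v - \<nu>) < 0"
proof -
  have \<nu>: "\<nu> \<in> polytope" using vert by (simp add: extreme_point_of_def)
  have d: "v - \<nu> \<in> direction" by (rule polytope_diff[OF v(1) \<nu>])
  obtain i where "i \<in> \<Omega>" "\<bar>\<nu> $ i\<bar> = 1" "(v - \<nu>) $ i \<noteq> 0"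
    using vertex_no_free_direction[OF vert d] v(2) by (metis eq_iff_diff_eq_0)
  then show ?thesis
    using relint_ncone_strict[OF \<nu> w d, of 1] v(1) by simp
qed

text \<open>
  Adding an element of \<open>range J\<close> to \<open>w\<close> does not change its projection.  Surjectivity at a vertex
  provides one that cancels the free coordinates.  The sign in a tight coordinate \<open>i\<close> is then read off
  by pairing with a direction that moves no other tight coordinate and moves \<open>i\<close> into the cube.
\<close>

lemma vertex_correction:
  assumes vert: "\<nu> extreme_point_of polytope" and I: "I = {i \<in> \<Omega>. \<bar>\<nu> $ i\<bar> < 1}"
    and rank: "dim (range (\<lambda>V. restr I (J V))) = dim (range J)"
    and w: "orth_proj direction w \<in> rel_interior (ncone \<nu>)"
  obtains Z where "\<And>i. i \<in> I \<Longrightarrow> (J Z + w) $ i = 0"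
    "\<And>i. i \<in> \<Omega> - I \<Longrightarrow> \<nu> $ i * (J Z + w) $ i > 0"
proof -
  have \<nu>: "\<nu> \<in> polytope" using vert by (simp add: extreme_point_of_def)
  have "- restr I w \<in> coord_space I" by (simp add: restr_def coord_space_def)
  then obtain Z where Z: "- restr I w = restr I (J Z)"
    using vertex_restr_surjective[OF vert I] by blast
  have free: "(J Z + w) $ i = 0" if "i \<in> I" for i
  proof -
    have "(- restr I w) $ i = restr I (J Z) $ i" using Z by simp
    then show ?thesis using that by (simp add: restr_def)
  qed
  have "\<nu> $ i * (J Z + w) $ i > 0" if i: "i \<in> \<Omega> - I" for i
  proof -
    have abs1: "\<bar>\<nu> $ j\<bar> = 1" if "j \<in> \<Omega> - I" for j
      using \<nu> that I by (force simp: polytope_def abs_le_iff)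
    define a :: "real^'m" where "a = axis i (- \<nu> $ i)"
    have "a \<in> coord_space (\<Omega> - I)" using i by (auto simp: a_def coord_space_def axis_def)
    then obtain d where d: "d \<in> direction" "\<And>j. j \<in> \<Omega> - I \<Longrightarrow> d $ j = a $ j"
      using active_coordinates_free[OF _ rank] I by blast
    have "\<nu> $ j * d $ j \<le> 0" if "j \<in> \<Omega>" "\<bar>\<nu> $ j\<bar> = 1" for j
    proof -
      have "j \<in> \<Omega> - I" using that I by auto
      then show ?thesis by (simp add: d(2) a_def axis_def)
    qed
    then obtain t where t: "t > 0" "\<nu> + t *\<^sub>R d \<in> polytope"
      using polytope_move[OF \<nu> d(1)] by blast
    have di: "d $ i = - \<nu> $ i" using d(2)[OF i] by (simp add: a_def)
    have "w \<bullet> d < 0"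
      using relint_ncone_strict[OF \<nu> w d(1) t, of i] i abs1[OF i] di by auto
    moreover have "J Z \<bullet> d = 0" using d(1) by (simp add: direction_iff)
    ultimately have "(J Z + w) \<bullet> d < 0" by (simp add: inner_add_left)
    moreover have "(J Z + w) \<bullet> d = (J Z + w) $ i * d $ i"
      unfolding inner_vec_def
    proof (subst sum.remove[of UNIV i])
      show "(J Z + w) $ i \<bullet> d $ i + (\<Sum>j\<in>UNIV - {i}. (J Z + w) $ j \<bullet> d $ j) = (J Z + w) $ i * d $ i"
      proof -
        have "(J Z + w) $ j \<bullet> d $ j = 0" if "j \<noteq> i" for j
        proof -
          consider "j \<in> I" | "j \<in> \<Omega> - I" | "j \<notin> \<Omega>" using I by blast
          then show ?thesis
          proof cases
            case 2
            then show ?thesis using d(2)[OF 2] that by (simp add: a_def axis_def)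
          next
            case 3
            then show ?thesis using d(1) by (simp add: direction_iff coord_space_def)
          qed (simp add: free del: vector_add_component)
        qed
        then show ?thesis by (simp add: sum.neutral)
      qed
    qed simp_all
    ultimately show ?thesis by (simp add: di mult.commute)
  qed
  then show ?thesis using that free by blast
qed

end

section \<open>The l1-norm of a quadratic map\<close>

text \<open>
  Comparing the form at \<open>V0\<close> and \<open>V0 \<plusminus> s *\<^sub>R V\<close>, all three in \<open>C\<close>, isolates its value at \<open>V\<close>.
\<close>

lemma quadratic_form_zero_on_subspace:
  fixes q :: "'a::euclidean_space \<Rightarrow> 'a \<Rightarrow> real"
  assumes q: "bounded_bilinear q" and W: "subspace W"
    and C: "openin (top_of_set W) C" "C \<noteq> {}" and zero: "\<And>V. V \<in> C \<Longrightarrow> q V V = 0"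
    and V: "V \<in> W"
  shows "q V V = 0"
proof -
  interpret q: bounded_bilinear q by (rule q)
  obtain V0 where V0: "V0 \<in> C" using C(2) by blast
  then obtain e where e: "e > 0" "ball V0 e \<inter> W \<subseteq> C"
    using C(1) by (meson openin_contains_ball)
  have V0W: "V0 \<in> W" using V0 C(1) openin_imp_subset by blast
  define s where "s = e / (norm V + 1)"
  have nV: "norm V + 1 > 0" by (simp add: add_nonneg_pos)
  have s: "s > 0" "s * norm V < e" using e(1) nV by (simp_all add: s_def field_simps)
  have inC: "V0 + c *\<^sub>R V \<in> C" if "\<bar>c\<bar> = s" for c
  proof -
    have "V0 + c *\<^sub>R V \<in> W" using V V0W W by (simp add: subspace_add subspace_scale)
    moreover have "V0 + c *\<^sub>R V \<in> ball V0 e" using that s by (simp add: dist_norm)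
    ultimately show ?thesis using e(2) by blast
  qed
  have expand: "q (V0 + c *\<^sub>R V) (V0 + c *\<^sub>R V)
      = q V0 V0 + c * (q V0 V + q V V0) + c\<^sup>2 * q V V" for c
    by (simp add: q.add_left q.add_right q.scaleR_left q.scaleR_right power2_eq_square algebra_simps)
  have "s\<^sup>2 * q V V = 0"
    using expand[of s] expand[of "- s"] zero[OF V0] zero[OF inC[of s]] zero[OF inC[of "- s"]] s(1)
    by simp
  then show ?thesis using s(1) by simp
qed

text \<open>
  Where a quadratic minorant touches \<open>f\<close>, its gradient is a regular subgradient of \<open>f\<close>.  The gradient is
  linear in the displacement from the centre \<open>u\<close> of the quadratic, which gives near-critical sequences
  as the touching points approach \<open>u\<close>.
\<close>

lemma quadratic_minorant_subgradient:
  fixes q :: "'a::euclidean_space \<Rightarrow> 'a \<Rightarrow> real"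
  assumes q: "bounded_bilinear q"
  obtains K where "K > 0"
    "\<And>f u c x. (\<And>z. f z \<ge> c + q (z - u) (z - u)) \<Longrightarrow> f x = c + q (x - u) (x - u)
       \<Longrightarrow> \<exists>v\<in>limiting_subdifferential f x. norm v \<le> K * norm (x - u)"
proof -
  interpret q: bounded_bilinear q by (rule q)
  obtain K where K: "K > 0" "\<And>a b. norm (q a b) \<le> norm a * norm b * K"
    using q.pos_bounded by blast
  have main: "\<exists>v\<in>limiting_subdifferential f x. norm v \<le> (2 * K) * norm (x - u)"
    if lower: "\<And>z. f z \<ge> c + q (z - u) (z - u)" and eq: "f x = c + q (x - u) (x - u)"
    for f u c x
  proof -
    define V where "V = x - u"
    define T where "T h = q V h + q h V" for h
    have "linear T"
      unfolding T_def by (auto intro!: linearI simp: q.add_left q.add_right q.scaleR_left q.scaleR_right algebra_simps)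
    define v where "v = adjoint T 1"
    have v: "v \<bullet> h = q V h + q h V" for h
      using adjoint_works[OF \<open>linear T\<close>, of h 1] by (simp add: v_def T_def inner_commute)
    have "norm v * norm v \<le> (2 * K * norm V) * norm v"
    proof -
      have "norm v * norm v = q V v + q v V" by (simp add: v[symmetric] norm_eq_sqrt_inner)
      also have "\<dots> \<le> (2 * K * norm V) * norm v"
        using K(2)[of V v] K(2)[of v V] by (simp add: algebra_simps)
      finally show ?thesis .
    qed
    then have nv: "norm v \<le> 2 * K * norm V"
      using K(1) by (cases "norm v = 0") (auto simp: mult_le_cancel_right)
    have "v \<in> regular_subdifferential f x"
      unfolding regular_subdifferential_def
    proof (intro CollectI allI impI)
      fix e :: real assume e: "e > 0"
      have "\<forall>\<^sub>F y in at x. dist y x < e / K"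
        using e K by (auto simp: eventually_at intro!: exI[of _ "e / K"])
      then show "\<forall>\<^sub>F y in at x. f y \<ge> f x + v \<bullet> (y - x) - e * norm (y - x)"
      proof eventually_elim
        case (elim y)
        define h where "h = y - x"
        have "q h h \<ge> - (norm h * norm h * K)" using K(2)[of h h] by simp
        moreover have "norm h * norm h * K \<le> e * norm h"
        proof -
          have "norm h * K \<le> e" using elim K(1) by (simp add: h_def dist_norm field_simps)
          then have "(norm h * K) * norm h \<le> e * norm h" by (intro mult_right_mono) auto
          then show ?thesis by (simp add: mult_ac)
        qed
        moreover have "q (y - u) (y - u) = q V V + v \<bullet> h + q h h"
        proof -
          have "y - u = V + h" by (simp add: V_def h_def)
          then show ?thesis by (simp add: v q.add_left q.add_right)
        qed
        ultimately show ?case using lower[of y] eq by (simp add: h_def V_def)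
      qed
    qed
    then have "v \<in> limiting_subdifferential f x"
      unfolding limiting_subdifferential_def
      by (intro CollectI exI[of _ "\<lambda>_. x"] exI[of _ "\<lambda>_. v"]) auto
    with nv show ?thesis by (auto simp: V_def)
  qed
  show ?thesis
  proof (rule that[of "2 * K"])
    show "\<exists>v\<in>limiting_subdifferential f x. norm v \<le> (2 * K) * norm (x - u)"
      if "\<And>z. f z \<ge> c + q (z - u) (z - u)" "f x = c + q (x - u) (x - u)" for f u c x
      using that by (rule main)
  qed (use K(1) in simp)
qed

text \<open>
  The \<open>\<ell>\<^sub>1\<close>-loss of a quadratic map, expanded around a point \<open>u\<close> where the residual is \<open>- \<epsilon>\<close>.
\<close>

locale l1_quadratic =
  fixes J :: "'a::euclidean_space \<Rightarrow> real^'m::finite" and B :: "'a \<Rightarrow> 'a \<Rightarrow> real^'m"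
    and \<epsilon> :: "real^'m" and u :: 'a and f :: "'a \<Rightarrow> real"
  assumes linear_J: "linear J" and bilinear_B: "bounded_bilinear B"
    and f_eq: "f z = (\<Sum>i\<in>UNIV. \<bar>(J (z - u) + B (z - u) (z - u) - \<epsilon>) $ i\<bar>)"
begin

definition resid :: "'a \<Rightarrow> real^'m" where "resid V = J V + B V V - \<epsilon>"

text \<open>
  These are the subgradients of the \<open>\<ell>\<^sub>1\<close>-norm at the residual \<open>- \<epsilon>\<close> that annihilate the range of the
  derivative \<open>J\<close>; each certifies criticality of \<open>u\<close>.
\<close>

definition multiplier :: "real^'m \<Rightarrow> bool" where
  "multiplier \<sigma> \<longleftrightarrow> (\<forall>i. \<bar>\<sigma> $ i\<bar> \<le> 1) \<and> (\<forall>i. \<epsilon> $ i \<noteq> 0 \<longrightarrow> \<sigma> $ i = - sgn (\<epsilon> $ i)) \<and>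
     (\<forall>V. \<sigma> \<bullet> J V = 0)"

sublocale B: bounded_bilinear B by (rule bilinear_B)

lemma f_shift: "f (u + V) = (\<Sum>i\<in>UNIV. \<bar>resid V $ i\<bar>)"
  by (simp add: f_eq resid_def)

lemma multiplier_resid:
  assumes "multiplier \<sigma>"
  shows "\<sigma> \<bullet> resid V = f u + \<sigma> \<bullet> B V V"
proof -
  have "\<sigma> \<bullet> \<epsilon> = - (\<Sum>i\<in>UNIV. \<bar>\<epsilon> $ i\<bar>)"
    unfolding inner_vec_def sum_negf[symmetric]
  proof (rule sum.cong)
    fix i
    show "\<sigma> $ i \<bullet> \<epsilon> $ i = - \<bar>\<epsilon> $ i\<bar>"
      using assms by (cases "\<epsilon> $ i = 0") (auto simp: multiplier_def sgn_if)
  qed simp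
  moreover have "f u = (\<Sum>i\<in>UNIV. \<bar>\<epsilon> $ i\<bar>)"
    using f_shift[of 0] by (simp add: resid_def linear_0[OF linear_J] B.zero_left)
  ultimately show ?thesis
    using assms by (simp add: resid_def inner_add_right inner_diff_right multiplier_def)
qed

text \<open>
  Pairing the residual with \<open>\<sigma>\<close> bounds its \<open>\<ell>\<^sub>1\<close>-norm from below.  The linear part drops out
  of the pairing, so the bound is a quadratic form centred at \<open>u\<close>.
\<close>

lemma multiplier_minorant:
  assumes "multiplier \<sigma>"
  shows "f z \<ge> f u + \<sigma> \<bullet> B (z - u) (z - u)"
proof -
  have "\<sigma> \<bullet> resid (z - u) \<le> (\<Sum>i\<in>UNIV. \<bar>resid (z - u) $ i\<bar>)"
    unfolding inner_vec_def
  proof (rule sum_mono)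
    fix i
    have "\<bar>\<sigma> $ i\<bar> * \<bar>resid (z - u) $ i\<bar> \<le> 1 * \<bar>resid (z - u) $ i\<bar>"
      using assms by (intro mult_right_mono) (auto simp: multiplier_def)
    then show "\<sigma> $ i \<bullet> resid (z - u) $ i \<le> \<bar>resid (z - u) $ i\<bar>"
      using abs_ge_self[of "\<sigma> $ i * resid (z - u) $ i"] by (simp add: abs_mult)
  qed
  then show ?thesis using multiplier_resid[OF assms] f_shift[of "z - u"] by simp
qed

lemma multiplier_exact:
  assumes "multiplier \<sigma>" "\<And>i. \<sigma> $ i * resid V $ i = \<bar>resid V $ i\<bar>"
  shows "f (u + V) = f u + \<sigma> \<bullet> B V V"
  using multiplier_resid[OF assms(1), of V] assms(2) by (simp add: f_shift inner_vec_def)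

text \<open>
  Points near \<open>u\<close> at which the minorant belonging to \<open>\<sigma>\<close> is attained.  The parabola
  \<open>t *\<^sub>R V + t\<^sup>2 *\<^sub>R Z\<close> gives the tight residuals the correct sign at order \<open>t\<^sup>2\<close> and satisfies the free
  equations up to order \<open>t ^ 3\<close>; \<open>metric_regularity\<close> solves the free equations exactly by a
  correction of order \<open>t ^ 3\<close>, too small to disturb those signs.
\<close>

lemma sign_consistent_sequence:
  assumes \<sigma>: "multiplier \<sigma>"
    and I: "I = {i. \<epsilon> $ i = 0 \<and> \<bar>\<sigma> $ i\<bar> < 1}"
    and surj: "coord_space I \<subseteq> range (\<lambda>V. restr I (J V))"
    and V: "\<And>i. \<epsilon> $ i = 0 \<Longrightarrow> J V $ i = 0"
    and free: "\<And>i. i \<in> I \<Longrightarrow> (J Z + B V V) $ i = 0"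
    and active: "\<And>i. \<epsilon> $ i = 0 \<Longrightarrow> i \<notin> I \<Longrightarrow> \<sigma> $ i * (J Z + B V V) $ i > 0"
  obtains t Vs where "\<And>n. t n > (0::real)" "t \<longlonglongrightarrow> 0" "(\<lambda>n. Vs n /\<^sub>R t n) \<longlonglongrightarrow> V"
    "\<And>n i. \<sigma> $ i * resid (Vs n) $ i = \<bar>resid (Vs n) $ i\<bar>"
proof -
  define G where "G V = restr I (J V + B V V)" for V
  define D where "D V = restr I (J V)" for V
  note restr_add = linear_add[OF linear_restr[of I]]
    and restr_diff = linear_diff[OF linear_restr[of I]]
    and restr_scale = linear_cmul[OF linear_restr[of I]]
  have norm_restr: "norm (restr I a) \<le> norm a" for a :: "real^'m"
    by (rule norm_le_componentwise_cart) (simp add: restr_def)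
  have lD: "linear D"
    by (auto intro!: linearI simp: D_def linear_add[OF linear_J] linear_cmul[OF linear_J] restr_add restr_scale)
  obtain K where K: "K > 0" "\<And>a b. norm (B a b) \<le> norm a * norm b * K"
    using B.pos_bounded by blast
  have "\<exists>d>0. \<forall>a\<in>ball 0 d. \<forall>b\<in>ball 0 d. norm (G a - G b - D (a - b)) \<le> e * norm (a - b)"
    if e: "e > 0" for e
  proof -
    have "norm (G a - G b - D (a - b)) \<le> e * norm (a - b)"
      if ab: "norm a < e / (2 * K)" "norm b < e / (2 * K)" for a b
    proof -
      have "G a - G b - D (a - b) = restr I (B a a - B b b)"
        by (simp add: G_def D_def restr_add restr_diff linear_diff[OF linear_J])
      also have "B a a - B b b = B a (a - b) + B (a - b) b" by (simp add: B.diff_left B.diff_right)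
      finally have "norm (G a - G b - D (a - b)) \<le> norm (B a (a - b) + B (a - b) b)"
        using norm_restr by metis
      also have "\<dots> \<le> norm a * norm (a - b) * K + norm (a - b) * norm b * K"
        by (rule norm_triangle_le[OF add_mono[OF K(2) K(2)]])
      also have "\<dots> = ((norm a + norm b) * K) * norm (a - b)" by (simp add: algebra_simps)
      also have "\<dots> \<le> e * norm (a - b)"
      proof (rule mult_right_mono)
        have "norm a + norm b \<le> e / K" using ab K by (simp add: field_simps)
        then show "(norm a + norm b) * K \<le> e" using K by (simp add: field_simps)
      qed simp
      finally show ?thesis .
    qed
    moreover have "e / (2 * K) > 0" using e K by simp
    ultimately show ?thesis by (intro exI[of _ "e / (2 * K)"]) simp
  qed
  then have strict: "strict_derivative G D 0" using lD by (simp add: strict_derivative_def)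
  have S: "subspace (coord_space I :: (real^'m) set)" by (rule subspace_coord_space)
  have SD: "coord_space I \<subseteq> range D" using surj by (simp add: D_def[abs_def])
  have G0: "G 0 = 0" by (simp add: G_def restr_def linear_0[OF linear_J] B.zero_left vec_eq_iff)
  have GS: "G V \<in> coord_space I" for V by (simp add: G_def restr_def coord_space_def)
  obtain k \<delta> where k: "k > 0" "\<delta> > 0"
    "\<And>z. z \<in> ball 0 \<delta> \<Longrightarrow> \<exists>z'\<in>ball 0 1. G z' = 0 \<and> norm (z' - z) \<le> k * norm (G z)"
    using metric_regularity[OF strict S SD G0, of 1] GS by (metis zero_less_one)
  define z where "z t = t *\<^sub>R V + t\<^sup>2 *\<^sub>R Z" for t :: real
  have JV: "restr I (J V) = 0" using V I by (simp add: restr_def vec_eq_iff)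
  have JZ: "restr I (J Z + B V V) = 0" using free by (auto simp: restr_def vec_eq_iff)
  have Gz: "G (z t) = t ^ 3 *\<^sub>R restr I (B V Z + B Z V + t *\<^sub>R B Z Z)" for t
  proof -
    have "J (z t) + B (z t) (z t) = t *\<^sub>R J V + t\<^sup>2 *\<^sub>R (J Z + B V V)
        + t ^ 3 *\<^sub>R (B V Z + B Z V + t *\<^sub>R B Z Z)"
      by (simp add: z_def linear_add[OF linear_J] linear_cmul[OF linear_J] B.add_left B.add_right
          B.scaleR_left B.scaleR_right scaleR_add_right power2_eq_square power3_eq_cube mult_ac)
    then show ?thesis
      unfolding G_def using JZ by (simp only: restr_add restr_scale JV scaleR_zero_right add_0)
  qed
  define C where "C = norm (B V Z) + norm (B Z V) + norm (B Z Z)"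
  have Gz_bound: "norm (G (z t)) \<le> t ^ 3 * C" if "0 < t" "t \<le> 1" for t
  proof -
    have "norm (restr I (B V Z + B Z V + t *\<^sub>R B Z Z)) \<le> norm (B V Z + B Z V + t *\<^sub>R B Z Z)"
      by (rule norm_restr)
    also have "\<dots> \<le> norm (B V Z) + norm (B Z V) + norm (t *\<^sub>R B Z Z)"
      by (intro norm_triangle_le add_mono norm_triangle_ineq order_refl)
    also have "\<dots> \<le> C" using that by (simp add: C_def mult_left_le_one_le)
    finally have "t ^ 3 * norm (restr I (B V Z + B Z V + t *\<^sub>R B Z Z)) \<le> t ^ 3 * C"
      using that by (intro mult_left_mono) auto
    then show ?thesis using that by (simp add: Gz)
  qed
  define T where "T n = inverse (real (Suc n))" for n
  have T: "T n > 0" "T n \<le> 1" for n by (simp_all add: T_def inverse_le_1_iff)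
  have T0: "T \<longlonglongrightarrow> 0" unfolding T_def by (rule LIMSEQ_inverse_real_of_nat)
  have "(\<lambda>n. z (T n)) \<longlonglongrightarrow> 0 *\<^sub>R V + 0\<^sup>2 *\<^sub>R Z"
    unfolding z_def by (intro tendsto_intros T0)
  then have "(\<lambda>n. z (T n)) \<longlonglongrightarrow> 0" by simp
  then have "\<forall>\<^sub>F n in sequentially. z (T n) \<in> ball 0 \<delta>"
    using k(2) by (intro topological_tendstoD) auto
  then have "\<forall>\<^sub>F n in sequentially. \<exists>z'. G z' = 0 \<and> norm (z' - z (T n)) \<le> k * norm (G (z (T n)))"
    by eventually_elim (use k(3) in blast)
  then obtain N0 where "\<And>n. n \<ge> N0 \<Longrightarrow> \<exists>z'. G z' = 0 \<and> norm (z' - z (T n)) \<le> k * norm (G (z (T n)))"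
    unfolding eventually_sequentially by blast
  then have "\<forall>n. \<exists>z'. n \<ge> N0 \<longrightarrow> G z' = 0 \<and> norm (z' - z (T n)) \<le> k * norm (G (z (T n)))" by blast
  then obtain Y where Y: "\<And>n. n \<ge> N0 \<Longrightarrow> G (Y n) = 0"
    "\<And>n. n \<ge> N0 \<Longrightarrow> norm (Y n - z (T n)) \<le> k * norm (G (z (T n)))"
    by metis
  define E where "E n = (Y n - z (T n)) /\<^sub>R (T n)\<^sup>2" for n
  have E0: "E \<longlonglongrightarrow> 0"
  proof (rule Lim_null_comparison)
    have "(\<lambda>n. k * C * T n) \<longlonglongrightarrow> k * C * 0" by (intro tendsto_intros T0)
    then show "(\<lambda>n. k * C * T n) \<longlonglongrightarrow> 0" by simp
    show "\<forall>\<^sub>F n in sequentially. norm (E n) \<le> k * C * T n"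
      unfolding eventually_sequentially
    proof (intro exI allI impI)
      fix n assume n: "n \<ge> N0"
      have "norm (Y n - z (T n)) \<le> k * (T n ^ 3 * C)"
        using Y(2)[OF n] Gz_bound[OF T(1,2), of n] k(1) by (meson dual_order.trans less_imp_le mult_left_mono)
      then have "norm (Y n - z (T n)) / (T n)\<^sup>2 \<le> k * (T n ^ 3 * C) / (T n)\<^sup>2"
        by (intro divide_right_mono) auto
      also have "\<dots> = k * C * T n" using T(1)[of n] by (simp add: power2_eq_square power3_eq_cube)
      also have "norm (Y n - z (T n)) / (T n)\<^sup>2 = norm (E n)"
        by (simp add: E_def divide_inverse_commute)
      finally show "norm (E n) \<le> k * C * T n" .
    qed
  qed
  have YE: "Y n = T n *\<^sub>R V + (T n)\<^sup>2 *\<^sub>R (Z + E n)" for n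
    using T(1)[of n] by (simp add: E_def z_def scaleR_add_right)
  have YV: "(\<lambda>n. Y n /\<^sub>R T n) \<longlonglongrightarrow> V"
  proof -
    have "(\<lambda>n. V + T n *\<^sub>R (Z + E n)) \<longlonglongrightarrow> V + 0 *\<^sub>R (Z + 0)"
      by (intro tendsto_intros T0 E0)
    moreover have "Y n /\<^sub>R T n = V + T n *\<^sub>R (Z + E n)" for n
    proof -
      have "inverse (T n) * (T n)\<^sup>2 = T n" using T(1)[of n] by (simp add: power2_eq_square)
      then show ?thesis
        using T(1)[of n] by (simp only: YE scaleR_add_right scaleR_scaleR) simp
    qed
    ultimately show ?thesis by simp
  qed
  have Y0: "Y \<longlonglongrightarrow> 0"
  proof -
    have "(\<lambda>n. T n *\<^sub>R V + (T n)\<^sup>2 *\<^sub>R (Z + E n)) \<longlonglongrightarrow> 0 *\<^sub>R V + 0\<^sup>2 *\<^sub>R (Z + 0)"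
      by (intro tendsto_intros T0 E0)
    then show ?thesis by (simp add: YE[abs_def])
  qed
  have J_lim: "(\<lambda>n. J (X n)) \<longlonglongrightarrow> J a" if "X \<longlonglongrightarrow> a" for X a
    using that linear_J linear_conv_bounded_linear bounded_linear.tendsto by blast
  have good: "\<forall>\<^sub>F n in sequentially. \<sigma> $ i * resid (Y n) $ i = \<bar>resid (Y n) $ i\<bar>" for i
  proof (cases "\<epsilon> $ i = 0")
    case False
    have "(\<lambda>n. \<sigma> $ i * resid (Y n) $ i) \<longlonglongrightarrow> \<sigma> $ i * (J 0 + B 0 0 - \<epsilon>) $ i"
      unfolding resid_def by (intro tendsto_intros tendsto_vec_nth J_lim B.tendsto Y0)
    moreover have "\<sigma> $ i * (J 0 + B 0 0 - \<epsilon>) $ i = \<bar>\<epsilon> $ i\<bar>"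
      using \<sigma> False by (auto simp: multiplier_def linear_0[OF linear_J] B.zero_left sgn_if)
    ultimately have "\<forall>\<^sub>F n in sequentially. \<sigma> $ i * resid (Y n) $ i > 0"
      using False by (intro order_tendstoD(1)) auto
    then show ?thesis
    proof eventually_elim
      case (elim n)
      have "\<bar>\<sigma> $ i\<bar> = 1" using \<sigma> False by (auto simp: multiplier_def abs_sgn_eq)
      then show ?case using elim by (metis abs_mult abs_of_pos mult_1)
    qed
  next
    case True
    show ?thesis
    proof (cases "i \<in> I")
      case I: True
      have "resid (Y n) $ i = 0" if "n \<ge> N0" for n
      proof -
        have "G (Y n) $ i = 0" using Y(1)[OF that] by simp
        then show ?thesis using I True by (simp add: G_def restr_def resid_def)
      qed
      then show ?thesis unfolding eventually_sequentially by (intro exI[of _ N0]) auto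
    next
      case I': False
      have resid: "resid (Y n) $ i = (T n)\<^sup>2 * (J (Z + E n) + B (Y n /\<^sub>R T n) (Y n /\<^sub>R T n)) $ i" for n
      proof -
        have "J (Y n) $ i = (T n)\<^sup>2 * J (Z + E n) $ i"
          by (subst YE) (simp add: linear_add[OF linear_J] linear_cmul[OF linear_J] V[OF True] del: scaleR_add_right)
        moreover have "B (c *\<^sub>R a) (c *\<^sub>R a) $ i = c\<^sup>2 * B a a $ i" for c a
          by (simp add: B.scaleR_left B.scaleR_right power2_eq_square)
        from this[of "T n" "Y n /\<^sub>R T n"]
        have "B (Y n) (Y n) $ i = (T n)\<^sup>2 * B (Y n /\<^sub>R T n) (Y n /\<^sub>R T n) $ i"
        proof -
          have "T n *\<^sub>R (Y n /\<^sub>R T n) = Y n" using T(1)[of n] by simp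
          with \<open>B (T n *\<^sub>R (Y n /\<^sub>R T n)) (T n *\<^sub>R (Y n /\<^sub>R T n)) $ i = _\<close>
          show ?thesis by (simp only:)
        qed
        ultimately show ?thesis using True by (simp add: resid_def distrib_left)
      qed
      have "(\<lambda>n. \<sigma> $ i * (J (Z + E n) + B (Y n /\<^sub>R T n) (Y n /\<^sub>R T n)) $ i)
          \<longlonglongrightarrow> \<sigma> $ i * (J (Z + 0) + B V V) $ i"
        by (intro tendsto_intros tendsto_vec_nth J_lim B.tendsto YV E0)
      then have "\<forall>\<^sub>F n in sequentially. \<sigma> $ i * (J (Z + E n) + B (Y n /\<^sub>R T n) (Y n /\<^sub>R T n)) $ i > 0"
        using active[OF True I'] by (intro order_tendstoD(1)) auto
      then show ?thesis
      proof eventually_elim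
        case (elim n)
        have "\<sigma> $ i * resid (Y n) $ i > 0"
        proof -
          have "(T n)\<^sup>2 * (\<sigma> $ i * (J (Z + E n) + B (Y n /\<^sub>R T n) (Y n /\<^sub>R T n)) $ i) > 0"
            using elim T(1)[of n] by (intro mult_pos_pos[of "(T n)\<^sup>2"]) simp_all
          then show ?thesis by (simp only: resid mult.left_commute)
        qed
        moreover have "\<bar>\<sigma> $ i\<bar> = 1"
          using \<sigma> I' True I unfolding multiplier_def by (metis (mono_tags, lifting) mem_Collect_eq order_le_less)
        ultimately show ?case by (metis abs_mult abs_of_pos mult_1)
      qed
    qed
  qed
  then have "\<forall>\<^sub>F n in sequentially. \<forall>i. \<sigma> $ i * resid (Y n) $ i = \<bar>resid (Y n) $ i\<bar>"
    by (simp add: eventually_all_finite)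
  then obtain N where N: "\<And>n i. n \<ge> N \<Longrightarrow> \<sigma> $ i * resid (Y n) $ i = \<bar>resid (Y n) $ i\<bar>"
    unfolding eventually_sequentially by blast
  \<comment> \<open>The tail is taken so that the sign relation holds along the entire sequence.\<close>
  show ?thesis
  proof (rule that[of "\<lambda>n. T (n + N)" "\<lambda>n. Y (n + N)"])
    show "(\<lambda>n. T (n + N)) \<longlonglongrightarrow> 0" by (rule LIMSEQ_ignore_initial_segment[OF T0])
    show "(\<lambda>n. Y (n + N) /\<^sub>R T (n + N)) \<longlonglongrightarrow> V"
      using LIMSEQ_ignore_initial_segment[OF YV, of N] .
  qed (use T N in auto)
qed

end

section \<open>Vertices and the second-order form\<close>

lemma bounded_bilinear_diff:
  fixes p q :: "'a::euclidean_space \<Rightarrow> 'b::euclidean_space \<Rightarrow> 'c::real_normed_vector"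
  assumes "bounded_bilinear p" "bounded_bilinear q"
  shows "bounded_bilinear (\<lambda>a b. p a b - q a b)"
proof -
  interpret p: bounded_bilinear p by fact
  interpret q: bounded_bilinear q by fact
  have "bilinear (\<lambda>a b. p a b - q a b)"
    unfolding bilinear_def
    by (auto intro!: linearI simp: p.add_left p.add_right p.scaleR_left p.scaleR_right
        q.add_left q.add_right q.scaleR_left q.scaleR_right scaleR_diff_right)
  then show ?thesis by (simp add: bilinear_conv_bounded_bilinear)
qed

context l1_quadratic
begin

definition clean_J :: "'a \<Rightarrow> real^'m" where "clean_J V = restr (Omega_C \<epsilon>) (J V)"
definition noisy_J :: "'a \<Rightarrow> real^'m" where "noisy_J V = restr (Omega_N \<epsilon>) (J V)"
definition clean_Q :: "'a \<Rightarrow> real^'m" where "clean_Q V = restr (Omega_C \<epsilon>) (B V V)"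

definition noise_sign :: "real^'m" where
  "noise_sign = restr (Omega_N \<epsilon>) (\<chi> i. sgn (\<epsilon> $ i))"

lemma linear_clean_J: "linear clean_J" and linear_noisy_J: "linear noisy_J"
proof -
  have "clean_J = restr (Omega_C \<epsilon>) \<circ> J" "noisy_J = restr (Omega_N \<epsilon>) \<circ> J"
    by (simp_all add: fun_eq_iff clean_J_def noisy_J_def)
  then show "linear clean_J" "linear noisy_J"
    by (simp_all only: linear_compose[OF linear_J linear_restr])
qed

sublocale clean: box_slice clean_J "Omega_C \<epsilon>" "adjoint noisy_J noise_sign"
  by (rule box_slice.intro[OF linear_clean_J]) (simp add: clean_J_def restr_def coord_space_def)

text \<open>
  A point of the polytope supplies the entries of a multiplier on the clean coordinates, while the
  noisy entries are the signs of the residual \<open>- \<epsilon>\<close>.  The defining equation of the polytope then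
  says that the two contributions cancel on the range of \<open>J\<close>.
\<close>

lemma multiplier_of_polytope:
  assumes "\<nu> \<in> clean.polytope"
  shows "multiplier (\<nu> - noise_sign)"
proof -
  have \<nu>: "\<nu> \<in> coord_space (Omega_C \<epsilon>)" "\<And>i. i \<in> Omega_C \<epsilon> \<Longrightarrow> \<bar>\<nu> $ i\<bar> \<le> 1"
    "adjoint clean_J \<nu> = adjoint noisy_J noise_sign"
    using assms by (auto simp: clean.polytope_def abs_le_iff)
  have "(\<nu> - noise_sign) \<bullet> J V = 0" for V
  proof -
    have "\<nu> \<bullet> J V = \<nu> \<bullet> clean_J V" "noise_sign \<bullet> J V = noise_sign \<bullet> noisy_J V"
      using \<nu>(1) by (auto simp: inner_vec_def clean_J_def noisy_J_def noise_sign_def restr_def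
          coord_space_def intro!: sum.cong)
    moreover have "clean_J V \<bullet> \<nu> = noisy_J V \<bullet> noise_sign"
      using adjoint_works[OF linear_clean_J, of V \<nu>] adjoint_works[OF linear_noisy_J, of V noise_sign] \<nu>(3)
      by simp
    ultimately show ?thesis by (simp add: inner_diff_left inner_commute[of \<nu>] inner_commute[of noise_sign])
  qed
  moreover have "(\<nu> - noise_sign) $ i = - sgn (\<epsilon> $ i)" if "\<epsilon> $ i \<noteq> 0" for i
    using \<nu>(1) that by (simp add: noise_sign_def restr_def coord_space_def Omega_C_def Omega_N_def)
  moreover have "\<bar>(\<nu> - noise_sign) $ i\<bar> \<le> 1" for i
  proof (cases "\<epsilon> $ i = 0")
    case True
    then show ?thesis using \<nu>(2)[of i] by (simp add: noise_sign_def restr_def Omega_C_def Omega_N_def)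
  next
    case False
    then show ?thesis
      using \<nu>(1) by (simp add: noise_sign_def restr_def coord_space_def Omega_C_def Omega_N_def abs_sgn_eq)
  qed
  ultimately show ?thesis by (simp add: multiplier_def)
qed

lemma bounded_bilinear_inner_B: "bounded_bilinear (\<lambda>a b. \<sigma> \<bullet> B a b)"
proof -
  have "bilinear (\<lambda>a b. \<sigma> \<bullet> B a b)"
    unfolding bilinear_def
    by (auto intro!: linearI simp: B.add_left B.add_right B.scaleR_left B.scaleR_right inner_add_right)
  then show ?thesis by (simp add: bilinear_conv_bounded_bilinear)
qed

text \<open>
  The gradients of the minorant are subgradients tending to \<open>0\<close>, so the form \<open>p\<close> governs the sequence;
  on the other hand \<open>f\<close> coincides with the minorant along it.
\<close>

lemma exact_sequence_value:
  assumes \<sigma>: "multiplier \<sigma>"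
    and p: "second_order_form f u p"
    and t: "\<And>n. t n > (0::real)" "t \<longlonglongrightarrow> 0" "(\<lambda>n. Vs n /\<^sub>R t n) \<longlonglongrightarrow> V"
    and exact: "\<And>n i. \<sigma> $ i * resid (Vs n) $ i = \<bar>resid (Vs n) $ i\<bar>"
  shows "p V V = \<sigma> \<bullet> B V V"
proof -
  interpret q: bounded_bilinear "\<lambda>a b. \<sigma> \<bullet> B a b"
    by (rule bounded_bilinear_inner_B)
  obtain K where K: "K > 0"
    "\<And>f u c x. (\<And>z. f z \<ge> c + \<sigma> \<bullet> B (z - u) (z - u)) \<Longrightarrow> f x = c + \<sigma> \<bullet> B (x - u) (x - u)
       \<Longrightarrow> \<exists>v\<in>limiting_subdifferential f x. norm v \<le> K * norm (x - u)"
    using quadratic_minorant_subgradient[OF bounded_bilinear_inner_B] by blast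
  have val: "f (u + Vs n) = f u + \<sigma> \<bullet> B (Vs n) (Vs n)" for n
    by (rule multiplier_exact[OF \<sigma> exact])
  have "\<exists>v\<in>limiting_subdifferential f (u + Vs n). norm v \<le> K * norm (u + Vs n - u)" for n
    by (rule K(2)[OF multiplier_minorant[OF \<sigma>]]) (simp add: val)
  then obtain vs where vs: "\<And>n. vs n \<in> limiting_subdifferential f (u + Vs n)"
    "\<And>n. norm (vs n) \<le> K * norm (Vs n)"
    by (metis add_diff_cancel_left')
  have "Vs \<longlonglongrightarrow> 0"
    using tendsto_of_difference_quotients[of t Vs 0 V] t by simp
  then have "(\<lambda>n. K * norm (Vs n)) \<longlonglongrightarrow> K * norm (0::'a)" by (intro tendsto_intros)
  then have "vs \<longlonglongrightarrow> 0"
    using vs(2) by (intro Lim_null_comparison[of vs "\<lambda>n. K * norm (Vs n)"]) auto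
  moreover have "(\<lambda>n. (u + Vs n - u) /\<^sub>R t n) \<longlonglongrightarrow> V" using t(3) by simp
  ultimately have "(\<lambda>n. (f (u + Vs n) - f u) / (t n)\<^sup>2) \<longlonglongrightarrow> p V V"
    using second_order_formD[OF p t(1,2), of "\<lambda>n. u + Vs n" V vs] vs(1) by blast
  moreover have "(f (u + Vs n) - f u) / (t n)\<^sup>2 = \<sigma> \<bullet> B (Vs n /\<^sub>R t n) (Vs n /\<^sub>R t n)" for n
    by (simp add: val q.scaleR_left q.scaleR_right power2_eq_square divide_inverse)
  ultimately have "(\<lambda>n. \<sigma> \<bullet> B (Vs n /\<^sub>R t n) (Vs n /\<^sub>R t n)) \<longlonglongrightarrow> p V V" by simp
  moreover have "(\<lambda>n. \<sigma> \<bullet> B (Vs n /\<^sub>R t n) (Vs n /\<^sub>R t n)) \<longlonglongrightarrow> \<sigma> \<bullet> B V V"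
    by (rule q.tendsto[OF t(3) t(3)])
  ultimately show ?thesis by (rule LIMSEQ_unique)
qed

text \<open>
  The curvature condition turns into residual signs via \<open>vertex_correction\<close>, so that near-critical
  points exist in the direction \<open>V\<close> and reveal the value of \<open>p\<close> there.
\<close>

lemma vertex_determines_form:
  assumes vert: "\<nu> extreme_point_of clean.polytope"
    and rank: "dim (range (\<lambda>V. restr (I_less \<epsilon> \<nu>) (clean_J V))) = dim (range clean_J)"
    and p: "second_order_form f u p"
    and V: "clean_J V = 0"
    and Q: "orth_proj clean.direction (clean_Q V) \<in> rel_interior (clean.ncone \<nu>)"
  shows "p V V = (\<nu> - noise_sign) \<bullet> B V V"
proof -
  have \<nu>: "\<nu> \<in> clean.polytope" using vert by (simp add: extreme_point_of_def)
  have \<sigma>: "multiplier (\<nu> - noise_sign)" by (rule multiplier_of_polytope[OF \<nu>])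
  have I: "I_less \<epsilon> \<nu> = {i \<in> Omega_C \<epsilon>. \<bar>\<nu> $ i\<bar> < 1}" by (simp add: I_less_def)
  have same: "(\<nu> - noise_sign) $ i = \<nu> $ i" if "\<epsilon> $ i = 0" for i
    using that by (simp add: noise_sign_def restr_def Omega_N_def)
  have I': "I_less \<epsilon> \<nu> = {i. \<epsilon> $ i = 0 \<and> \<bar>(\<nu> - noise_sign) $ i\<bar> < 1}"
    using same by (auto simp: I_less_def Omega_C_def)
  obtain Z where Z: "\<And>i. i \<in> I_less \<epsilon> \<nu> \<Longrightarrow> (clean_J Z + clean_Q V) $ i = 0"
    "\<And>i. i \<in> Omega_C \<epsilon> - I_less \<epsilon> \<nu> \<Longrightarrow> \<nu> $ i * (clean_J Z + clean_Q V) $ i > 0"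
    using clean.vertex_correction[OF vert I rank Q] by blast
  have full: "(clean_J Z + clean_Q V) $ i = (J Z + B V V) $ i" if "\<epsilon> $ i = 0" for i
    using that by (simp add: clean_J_def clean_Q_def restr_def Omega_C_def)
  have surj: "coord_space (I_less \<epsilon> \<nu>) \<subseteq> range (\<lambda>V. restr (I_less \<epsilon> \<nu>) (J V))"
  proof -
    have "restr (I_less \<epsilon> \<nu>) (clean_J V) = restr (I_less \<epsilon> \<nu>) (J V)" for V
      by (simp add: restr_def clean_J_def I_less_def vec_eq_iff)
    then show ?thesis using clean.vertex_restr_surjective[OF vert I] by simp
  qed
  have JV: "J V $ i = 0" if "\<epsilon> $ i = 0" for i
  proof -
    have "clean_J V $ i = 0" using V by simp
    then show ?thesis using that by (simp add: clean_J_def restr_def Omega_C_def)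
  qed
  have free: "(J Z + B V V) $ i = 0" if "i \<in> I_less \<epsilon> \<nu>" for i
    using Z(1)[OF that] full[of i] that by (simp add: I_less_def Omega_C_def)
  have active: "(\<nu> - noise_sign) $ i * (J Z + B V V) $ i > 0"
    if "\<epsilon> $ i = 0" "i \<notin> I_less \<epsilon> \<nu>" for i
    unfolding same[OF that(1)] full[OF that(1), symmetric]
    by (rule Z(2)) (use that in \<open>simp add: Omega_C_def\<close>)
  obtain t Vs where seq: "\<And>n. t n > (0::real)" "t \<longlonglongrightarrow> 0" "(\<lambda>n. Vs n /\<^sub>R t n) \<longlonglongrightarrow> V"
    "\<And>n i. (\<nu> - noise_sign) $ i * resid (Vs n) $ i = \<bar>resid (Vs n) $ i\<bar>"
    using sign_consistent_sequence[OF \<sigma> I' surj JV free active] by blast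
  show ?thesis by (rule exact_sequence_value[OF \<sigma> p seq])
qed

text \<open>
  On each of the two relatively open sets the second-order form of the manifold equals the quadratic
  form of the corresponding vertex, hence on all of \<open>W\<close>.  The two vertex forms would therefore agree on \<open>W\<close>,
  while on \<open>C1\<close> the relative interior of the normal cone strictly separates \<open>\<nu>1\<close> from \<open>\<nu>2\<close>.
\<close>

theorem no_C2_identifiable_manifold:
  assumes vert: "\<nu>1 extreme_point_of clean.polytope" "\<nu>2 extreme_point_of clean.polytope"
    and ne: "\<nu>1 \<noteq> \<nu>2"
    and rank: "\<And>\<nu>. \<nu> extreme_point_of clean.polytope \<Longrightarrow>
      dim (range (\<lambda>V. restr (I_less \<epsilon> \<nu>) (clean_J V))) = dim (range clean_J)"
    and W: "subspace W" "\<And>V. V \<in> W \<Longrightarrow> clean_J V = 0"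
    and C1: "openin (top_of_set W) C1" "C1 \<noteq> {}" and C2: "openin (top_of_set W) C2" "C2 \<noteq> {}"
    and Q1: "\<And>V. V \<in> C1 \<Longrightarrow> orth_proj clean.direction (clean_Q V) \<in> rel_interior (clean.ncone \<nu>1)"
    and Q2: "\<And>V. V \<in> C2 \<Longrightarrow> orth_proj clean.direction (clean_Q V) \<in> rel_interior (clean.ncone \<nu>2)"
  shows "\<not> C2_identifiable_manifold f M u 0"
proof
  assume M: "C2_identifiable_manifold f M u 0"
  have poly: "\<nu>1 \<in> clean.polytope" "\<nu>2 \<in> clean.polytope"
    using vert by (simp_all add: extreme_point_of_def)
  have \<sigma>: "multiplier (\<nu>1 - noise_sign)" by (rule multiplier_of_polytope[OF poly(1)])
  interpret q: bounded_bilinear "\<lambda>a b. (\<nu>1 - noise_sign) \<bullet> B a b" by (rule bounded_bilinear_inner_B)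
  obtain K where K: "\<And>a b. norm ((\<nu>1 - noise_sign) \<bullet> B a b) \<le> norm a * norm b * K"
    using q.bounded by blast
  have "f u - K * (norm (z - u))\<^sup>2 \<le> f z" for z
    using multiplier_minorant[OF \<sigma>, of z] K[of "z - u" "z - u"] by (simp add: power2_eq_square mult_ac)
  then have lower: "\<forall>\<^sub>F z in nhds u. f u - K * (norm (z - u))\<^sup>2 \<le> f z" by simp
  obtain p where p: "second_order_form f u p"
    using identifiable_manifold_second_order_form[OF M lower] by blast
  have forms: "p V V = (\<nu> - noise_sign) \<bullet> B V V"
    if \<nu>: "\<nu> extreme_point_of clean.polytope" and C: "openin (top_of_set W) C" "C \<noteq> {}"
      and Q: "\<And>V. V \<in> C \<Longrightarrow> orth_proj clean.direction (clean_Q V) \<in> rel_interior (clean.ncone \<nu>)"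
      and V: "V \<in> W" for \<nu> C V
  proof -
    have CW: "C \<subseteq> W" using C(1) by (rule openin_imp_subset)
    have "bounded_bilinear (\<lambda>a b. p a b - (\<nu> - noise_sign) \<bullet> B a b)"
      by (rule bounded_bilinear_diff[OF second_order_form_bilinear[OF p] bounded_bilinear_inner_B])
    moreover have "p V' V' - (\<nu> - noise_sign) \<bullet> B V' V' = 0" if "V' \<in> C" for V'
      using vertex_determines_form[OF \<nu> rank[OF \<nu>] p W(2) Q] that CW by (simp add: subsetD)
    ultimately have "p V V - (\<nu> - noise_sign) \<bullet> B V V = 0"
      by (rule quadratic_form_zero_on_subspace[OF _ W(1) C _ V])
    then show ?thesis by simp
  qed
  obtain V where V: "V \<in> C1" using C1(2) by blast
  then have VW: "V \<in> W" using C1(1) openin_imp_subset by blast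
  have "\<nu>1 \<bullet> B V V = \<nu>2 \<bullet> B V V"
    using forms[OF vert(1) C1 Q1 VW] forms[OF vert(2) C2 Q2 VW] by (simp add: inner_diff_left)
  moreover have "\<nu> \<bullet> B V V = clean_Q V \<bullet> \<nu>" if "\<nu> \<in> clean.polytope" for \<nu>
    using that by (auto simp: clean.polytope_def coord_space_def clean_Q_def restr_def inner_vec_def
        mult.commute intro!: sum.cong)
  ultimately have "clean_Q V \<bullet> (\<nu>2 - \<nu>1) = 0" using poly by (simp add: inner_diff_right)
  moreover have "clean_Q V \<bullet> (\<nu>2 - \<nu>1) < 0"
    using clean.relint_ncone_separates[OF vert(1) poly(2) _ Q1[OF V]] ne by simp
  ultimately show False by simp
qed

end

section \<open>Robust low-rank recovery as an l1-quadratic problem\<close>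

lemma matrix_add_mult_distrib: "(Y + Z) ** M = Y ** M + Z ** (M :: real^'l^'k)"
  by (simp add: matrix_matrix_mult_def vec_eq_iff distrib_right sum.distrib)

lemma meas_add: "meas A (Y + Z) = meas A Y + meas A Z"
  by (simp add: meas_def vec_eq_iff inner_add_right)

lemma meas_scaleR: "meas A (c *\<^sub>R Z) = c *\<^sub>R meas A Z"
  by (simp add: meas_def vec_eq_iff)

lemma transpose_add: "transpose (Y + Z) = transpose Y + transpose (Z :: real^'k^'n)"
  by (simp add: transpose_def vec_eq_iff)

text \<open>
  \<open>L\<close> is constrained on symmetric matrices only, whereas the bilinear map \<open>V ** transpose V'\<close> takes
  arbitrary values.  Symmetrising first gives a map that is linear on all matrices.
\<close>

definition sym_meas :: "('m::finite \<Rightarrow> real^'n^'n) \<Rightarrow> (real^'n^'n \<Rightarrow> real^'n^'n) \<Rightarrow> real^'n^'n \<Rightarrow> real^'m" where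
  "sym_meas A L Z = meas A (L ((1/2) *\<^sub>R (Z + transpose Z)))"

lemma sym_meas_eq: "sym_mat Z \<Longrightarrow> sym_meas A L Z = meas A (L Z)"
  by (simp add: sym_meas_def sym_mat_def scaleR_2[symmetric])

lemma linear_sym_meas:
  fixes A :: "'m::finite \<Rightarrow> real^'n^'n"
  assumes "linear_on_sym L"
  shows "linear (sym_meas A L)"
proof -
  have sym: "sym_mat (Z + transpose Z)" for Z :: "real^'n^'n"
    by (simp add: sym_mat_def transpose_add add.commute)
  then have sym2: "sym_mat ((1/2) *\<^sub>R (Z + transpose Z))" for Z :: "real^'n^'n"
    by (simp add: sym_mat_def transpose_scalar)
  show ?thesis
  proof (rule linearI)
    fix Y Z :: "real^'n^'n"
    have "(1/2) *\<^sub>R (Y + Z + transpose (Y + Z))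
        = (1/2) *\<^sub>R (Y + transpose Y) + (1/2) *\<^sub>R (Z + transpose Z)"
      by (simp add: transpose_add algebra_simps)
    then show "sym_meas A L (Y + Z) = sym_meas A L Y + sym_meas A L Z"
      using assms sym2 unfolding sym_meas_def linear_on_sym_def by (simp only: meas_add)
  next
    fix c and Z :: "real^'n^'n"
    have "(1/2) *\<^sub>R (c *\<^sub>R Z + transpose (c *\<^sub>R Z)) = c *\<^sub>R ((1/2) *\<^sub>R (Z + transpose Z))"
      by (simp add: transpose_scalar algebra_simps)
    then show "sym_meas A L (c *\<^sub>R Z) = c *\<^sub>R sym_meas A L Z"
      using assms sym2 unfolding sym_meas_def linear_on_sym_def by (simp only: meas_scaleR)
  qed
qed

lemma sym_mat_gram: "sym_mat (V ** transpose V)"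
  by (simp add: sym_mat_def matrix_transpose_mul)

lemma sym_mat_polar: "sym_mat (U ** transpose V + V ** transpose U)"
  by (simp add: sym_mat_def transpose_add matrix_transpose_mul add.commute)

lemma f_LR_l1_quadratic:
  fixes A :: "'m::finite \<Rightarrow> real^'n^'n" and U :: "real^'k^'n"
  assumes L: "linear_on_sym L" and y: "y = meas A (L (U ** transpose U)) + \<epsilon>"
  shows "l1_quadratic (\<lambda>V. meas A (L (U ** transpose V + V ** transpose U)))
    (\<lambda>V V'. sym_meas A L (V ** transpose V')) \<epsilon> U (f_LR A L y)"
proof (rule l1_quadratic.intro)
  note lin = linear_sym_meas[OF L, of A]
  have J: "meas A (L (U ** transpose V + V ** transpose U)) = sym_meas A L (U ** transpose V + V ** transpose U)" for V
    by (simp add: sym_meas_eq sym_mat_polar)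
  show "linear (\<lambda>V. meas A (L (U ** transpose V + V ** transpose U)))"
  proof (rule linearI)
    fix V V' :: "real^'k^'n"
    have "U ** transpose (V + V') + (V + V') ** transpose U
       = (U ** transpose V + V ** transpose U) + (U ** transpose V' + V' ** transpose U)"
      by (simp add: transpose_add matrix_add_ldistrib matrix_add_mult_distrib)
    then show "meas A (L (U ** transpose (V + V') + (V + V') ** transpose U))
      = meas A (L (U ** transpose V + V ** transpose U)) + meas A (L (U ** transpose V' + V' ** transpose U))"
      unfolding J by (simp only: linear_add[OF lin])
  next
    fix c and V :: "real^'k^'n"
    have "U ** transpose (c *\<^sub>R V) + (c *\<^sub>R V) ** transpose U
       = c *\<^sub>R (U ** transpose V + V ** transpose U)"
      by (simp add: transpose_scalar matrix_scalar_ac scalar_matrix_assoc scaleR_add_right)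
    then show "meas A (L (U ** transpose (c *\<^sub>R V) + (c *\<^sub>R V) ** transpose U))
      = c *\<^sub>R meas A (L (U ** transpose V + V ** transpose U))"
      unfolding J by (simp only: linear_cmul[OF lin])
  qed
  have "bilinear (\<lambda>V V' :: real^'k^'n. sym_meas A L (V ** transpose V'))"
    unfolding bilinear_def
    by (auto intro!: linearI simp: transpose_add transpose_scalar matrix_add_ldistrib matrix_add_mult_distrib
        matrix_scalar_ac scalar_matrix_assoc[symmetric] linear_add[OF lin] linear_cmul[OF lin])
  then show "bounded_bilinear (\<lambda>V V' :: real^'k^'n. sym_meas A L (V ** transpose V'))"
    by (simp add: bilinear_conv_bounded_bilinear)
  fix z :: "real^'k^'n"
  define V where "V = z - U"
  have "z ** transpose z = U ** transpose U + (U ** transpose V + V ** transpose U) + V ** transpose V"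
  proof -
    have "z = U + V" by (simp add: V_def)
    then show ?thesis by (simp add: transpose_add matrix_add_ldistrib matrix_add_mult_distrib add_ac)
  qed
  then have "sym_meas A L (z ** transpose z) = sym_meas A L (U ** transpose U)
      + sym_meas A L (U ** transpose V + V ** transpose U) + sym_meas A L (V ** transpose V)"
    by (simp only: linear_add[OF lin])
  then have "meas A (L (z ** transpose z)) - y
      = meas A (L (U ** transpose V + V ** transpose U)) + sym_meas A L (V ** transpose V) - \<epsilon>"
    by (simp add: y J sym_meas_eq[OF sym_mat_gram])
  then show "f_LR A L y z = (\<Sum>i\<in>UNIV. \<bar>(meas A (L (U ** transpose (z - U) + (z - U) ** transpose U))
      + sym_meas A L ((z - U) ** transpose (z - U)) - \<epsilon>) $ i\<bar>)"
    unfolding f_LR_def V_def by simp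
qed

section \<open>Inactivity of the factorised recovery problem\<close>

theorem theorem5p11:
  fixes A :: "'m::finite \<Rightarrow> real^'n^'n"
    and L :: "real^'n^'n \<Rightarrow> real^'n^'n"
    and X :: "real^'n^'n"
    and \<epsilon> y :: "real^'m"
    and U :: "real^'k^'n"
    and r :: nat
    and \<nu>1 \<nu>2 :: "real^'m"
    and W C1 C2 :: "(real^'k^'n) set"
  assumes A_sym: "\<And>i. sym_mat (A i)"
    and L_lin: "linear_on_sym L"
    and X_psd: "psd_mat X"
    and X_rank: "rank X = r" "r \<le> CARD('k)"
    and y: "y = meas A (L X) + \<epsilon>"
    and crit: "critical_point (f_LR A L y) U"
    and UX: "U ** transpose U = X"
    and I: "condition_I A L \<epsilon> U"
    and N: "condition_N A L \<epsilon> U"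
    and vert1: "\<nu>1 extreme_point_of Lambda_C A L \<epsilon> U"
    and vert2: "\<nu>2 extreme_point_of Lambda_C A L \<epsilon> U"
    and distinct_vert: "\<nu>1 \<noteq> \<nu>2"
    and W: "subspace W" "W \<subseteq> {V. J_C A L \<epsilon> U V = 0}"
    and C1: "C1 \<noteq> {}" "rel_open_cone W C1"
    and C2: "C2 \<noteq> {}" "rel_open_cone W C2"
    and Q1: "\<And>V. V \<in> C1 \<Longrightarrow>
        orth_proj (N_C A L \<epsilon> U) (Q_C A L \<epsilon> V) \<in> rel_interior (rel_normal_cone A L \<epsilon> U \<nu>1)"
    and Q2: "\<And>V. V \<in> C2 \<Longrightarrow>
        orth_proj (N_C A L \<epsilon> U) (Q_C A L \<epsilon> V) \<in> rel_interior (rel_normal_cone A L \<epsilon> U \<nu>2)"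
  shows "inactive (f_LR A L y) U"
proof -
  interpret q: l1_quadratic "\<lambda>V. meas A (L (U ** transpose V + V ** transpose U))"
    "\<lambda>V V'. sym_meas A L (V ** transpose V')" \<epsilon> U "f_LR A L y"
    by (rule f_LR_l1_quadratic[OF L_lin]) (simp add: y UX)
  have J_C: "J_C A L \<epsilon> U = q.clean_J" and J_N: "J_N A L \<epsilon> U = q.noisy_J"
    by (auto simp: fun_eq_iff J_C_def J_N_def q.clean_J_def q.noisy_J_def)
  have Q_C: "Q_C A L \<epsilon> = q.clean_Q"
    by (auto simp: fun_eq_iff Q_C_def q.clean_Q_def sym_meas_eq sym_mat_gram)
  have N_C: "N_C A L \<epsilon> U = q.clean.direction"
    by (simp add: N_C_def q.clean.direction_def J_C)
  have sign: "restr (Omega_N \<epsilon>) (\<chi> i. sgn (\<epsilon> $ i)) = q.noise_sign"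
    by (simp add: q.noise_sign_def)
  have Lambda: "Lambda_C A L \<epsilon> U = q.clean.polytope"
    by (simp only: Lambda_C_def q.clean.polytope_def J_C J_N sign)
  have cone: "rel_normal_cone A L \<epsilon> U = q.clean.ncone"
    by (simp add: fun_eq_iff rel_normal_cone_def q.clean.ncone_def N_C Lambda)
  have "\<not> C2_identifiable_manifold (f_LR A L y) M U 0" for M
  proof (rule q.no_C2_identifiable_manifold)
    show "\<nu>1 extreme_point_of q.clean.polytope" "\<nu>2 extreme_point_of q.clean.polytope" "\<nu>1 \<noteq> \<nu>2"
      using vert1 vert2 distinct_vert by (simp_all add: Lambda)
    show "dim (range (\<lambda>V. restr (I_less \<epsilon> \<nu>) (q.clean_J V))) = dim (range q.clean_J)"
      if "\<nu> extreme_point_of q.clean.polytope" for \<nu>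
      using N that by (simp add: condition_N_def Lambda J_C)
    show "subspace W" by (rule W(1))
    show "q.clean_J V = 0" if "V \<in> W" for V using W(2) that J_C by auto
    show "openin (top_of_set W) C1" "C1 \<noteq> {}" "openin (top_of_set W) C2" "C2 \<noteq> {}"
      using C1 C2 by (simp_all add: rel_open_cone_def)
    show "orth_proj q.clean.direction (q.clean_Q V) \<in> rel_interior (q.clean.ncone \<nu>1)" if "V \<in> C1" for V
      using Q1[OF that] by (simp add: N_C Q_C cone)
    show "orth_proj q.clean.direction (q.clean_Q V) \<in> rel_interior (q.clean.ncone \<nu>2)" if "V \<in> C2" for V
      using Q2[OF that] by (simp add: N_C Q_C cone)
  qed
  then show ?thesis using crit by (simp add: inactive_def)
qed

end
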